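(* Let $\mathcal{X}$ be a finite state space, let $\mu$ be a target distribution on $\mathcal{X}$ with $\mu(x)>0$ for all $x\in\mathcal{X}$, and let $Q$ be the generator of an irreducible continuous-time Markov chain on $\mathcal{X}$ (the proposal chain). Let $M_1=M_1(Q,\mu)$ and $M_2=M_2(Q,\mu)$ be the two Metropolis-Hastings generators. Then: (1) (Hitting times) For $\lambda>0$ and $A\subseteq\mathcal{X}$, $$\mathbb{E}_{\mu}(e^{-\lambda \tau_A(M_1)}) \leq \mathbb{E}_{\mu}(e^{-\lambda \tau_A(M_2)}).$$ In particular, $\mathbb{E}_{\mu}(\tau_A(M_1)) \geq \mathbb{E}_{\mu}(\tau_A(M_2))$. Furthermore, $t_{av}(M_1,\mu)\geq t_{av}(M_2,\mu)$. (2) (Total variation mixing time) There exists a positive constant $C_\mu$ that depends on $\mu$ such that $$t_{mix}(M_2,\mu,1/4)\leq C_\mu\, t_{mix}(M_1,\mu,1/4).$$ That is, $t_{mix}(M_2,\mu,1/4)\lesssim_\mu t_{mix}(M_1,\mu,1/4)$. (3) (Spectral gap) $\lambda_2(M_1,\mu)\leq\lambda_2(M_2,\mu)$. That is, the exponential $\ell^2$-convergence rate of chain $M_2$ is faster than that of chain $M_1$, or $t_{rel}(M_1,\mu)\geq t_{rel}(M_2,\mu)$. (4) (Asymptotic variance) For $h\in\ell^2_0(\mu)=\{h:\mu(h)=0\}$, $$\sigma^2(h,M_1,\mu)\geq\sigma^2(h,M_2,\mu).$$ (5) (Large deviations) For any probability distribution $\nu$ on $\mathcal{X}$, $I(M_1,\nu)\leq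 I(M_2,\nu)$. That is, the deviations for chain $M_2$ from the invariant distribution are asymptotically less likely than for $M_1$. (6) (Capacity) For any disjoint $A,B\subseteq\mathcal{X}$, $$\mathrm{cap}(A,B,M_1,\mu)\leq\mathrm{cap}(A,B,M_2,\mu).$$ In particular, if we take $A=\{x\}$ and $B=\{y\}$, then $t_{com}^{x,y}(M_1)\geq t_{com}^{x,y}(M_2)$.
   Context: A Markov generator on $\mathcal{X}$ is a real matrix with nonnegative off-diagonal entries and zero row sums. Metropolis-Hastings generators: for $x\neq y$, $$M_1(x,y)=\min\Big\{Q(x,y),\tfrac{\mu(y)}{\mu(x)}Q(y,x)\Big\},\qquad M_2(x,y)=\max\Big\{Q(x,y),\tfrac{\mu(y)}{\mu(x)}Q(y,x)\Big\},$$ and $M_i(x,x)=-\sum_{z\neq x}M_i(x,z)$ for $i=1,2$. Both are reversible with respect to $\mu$. Below, $G$ is a generator on $\mathcal{X}$ with stationary distribution $\pi$, $X=(X_t)_{t\geq0}$ is the associated continuous-time chain and $(P_t)_{t\geq 0}$ its transition semigroup. $\mathbb{P}_x,\mathbb{E}_x$ refer to the chain started at $x$, and $\mathbb{E}_\pi$ to initial law $\pi$. Write $\pi(f)=\sum_x f(x)\pi(x)$ and $\langle f,g\rangle_\pi=\sum_x f(x)g(x)\pi(x)$ for real functions on $\mathcal{X}$. The convention $\inf\emptyset=\infty$ is used. - Hitting time: $\tau_A(G)=\inf\{t\geq0: X_t\in A\}$; first return time: $\tau_A^+(G)=\inf\{t>0: X_t\in A\text{ and there exists } s\in(0,t)\text{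 such that }X_s\neq X_0\}$; $\tau_y=\tau_{\{y\}}$, $\tau_y^+=\tau_{\{y\}}^+$. - Commute time: $t_{com}^{x,y}(G)=\mathbb{E}_x(\tau_y(G))+\mathbb{E}_y(\tau_x(G))$. - Average hitting time: $t_{av}(G,\pi)=\sum_{x,y}\mathbb{E}_x(\tau_y(G))\pi(x)\pi(y)$. - Mixing time: $t_{mix}(G,\pi,\epsilon)=\inf\{t\geq0:\sup_x\|P_t(x,\cdot)-\pi\|_{TV}<\epsilon\}$, with $\|\nu-\pi\|_{TV}=\frac12\sum_x|\nu(x)-\pi(x)|$. The notation $a\lesssim_\mu b$ means $a\leq C_\mu b$ for a positive constant $C_\mu$ depending on $\mu$. - Spectral gap: $\lambda_2(G,\pi)=\inf\{\langle -Gf,f\rangle_\pi:\pi(f)=0,\ \pi(f^2)=1\}$; relaxation time $t_{rel}(G,\pi)=1/\lambda_2(G,\pi)$. - Asymptotic variance: for $f$ with $\pi(f)=0$, $\sigma^2(f,G,\pi)=-2\langle f,g\rangle_\pi$, where $g$ solves the Poisson equation $Gg=f$. - Large deviation rate function: $I(G,\nu)=\sup_{u>0}\big(-\sum_{x}\nu(x)\frac{Gu(x)}{u(x)}\big)$, the supremum being over strictly positive functions $u$ on $\mathcal{X}$. - Capacity: for disjoint $A,B\subseteq\mathcal{X}$, $\mathrm{cap}(A,B,G,\pi)=\sum_{x\in A}\pi(x)\,\mathbb{P}_x(\tau_A^+(G)>\tau_B^+(G))$.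
   Formalization: In (6) the capacity carries the holding rate, summing π(x)(-G(x,x))P_x(τ_A^+>τ_B^+), and the commute time inequality is claimed only for irreducible M_1; as written both fail on 3 states. In (4) the asymptotic variance is ∞ if the Poisson equation has no solution. *)

theory Defs
  imports "HOL-Probability.Probability"
begin

section \<open>Generators and Metropolis-Hastings generators\<close>

text \<open>The finite state space is a type of class \<^class>\<open>finite\<close>; generators are real matrices
  written as functions of two states.\<close>

definition generator :: "('a::finite \<Rightarrow> 'a \<Rightarrow> real) \<Rightarrow> bool" where
  "generator G \<longleftrightarrow> (\<forall>x y. x \<noteq> y \<longrightarrow> 0 \<le> G x y) \<and> (\<forall>x. (\<Sum>y\<in>UNIV. G x y) = 0)"

definition irreducible_gen :: "('a::finite \<Rightarrow> 'a \<Rightarrow> real) \<Rightarrow> bool" where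
  "irreducible_gen G \<longleftrightarrow> (\<forall>x y. (x, y) \<in> {(u, v). u \<noteq> v \<and> 0 < G u v}\<^sup>*)"

definition prob_vec :: "('a::finite \<Rightarrow> real) \<Rightarrow> bool" where
  "prob_vec \<pi> \<longleftrightarrow> (\<forall>x. 0 \<le> \<pi> x) \<and> (\<Sum>x\<in>UNIV. \<pi> x) = 1"

definition MH1 :: "('a::finite \<Rightarrow> 'a \<Rightarrow> real) \<Rightarrow> ('a \<Rightarrow> real) \<Rightarrow> 'a \<Rightarrow> 'a \<Rightarrow> real" where
  "MH1 Q \<mu> x y =
     (if x = y then - (\<Sum>z\<in>UNIV - {x}. min (Q x z) (\<mu> z / \<mu> x * Q z x))
      else min (Q x y) (\<mu> y / \<mu> x * Q y x))"

definition MH2 :: "('a::finite \<Rightarrow> 'a \<Rightarrow> real) \<Rightarrow> ('a \<Rightarrow> real) \<Rightarrow> 'a \<Rightarrow> 'a \<Rightarrow> real" where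
  "MH2 Q \<mu> x y =
     (if x = y then - (\<Sum>z\<in>UNIV - {x}. max (Q x z) (\<mu> z / \<mu> x * Q z x))
      else max (Q x y) (\<mu> y / \<mu> x * Q y x))"

definition gen_app :: "('a::finite \<Rightarrow> 'a \<Rightarrow> real) \<Rightarrow> ('a \<Rightarrow> real) \<Rightarrow> 'a \<Rightarrow> real" where
  "gen_app G f x = (\<Sum>y\<in>UNIV. G x y * f y)"

definition mean :: "('a::finite \<Rightarrow> real) \<Rightarrow> ('a \<Rightarrow> real) \<Rightarrow> real" where
  "mean \<pi> f = (\<Sum>x\<in>UNIV. f x * \<pi> x)"

definition inner_wt :: "('a::finite \<Rightarrow> real) \<Rightarrow> ('a \<Rightarrow> real) \<Rightarrow> ('a \<Rightarrow> real) \<Rightarrow> real" where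
  "inner_wt \<pi> f g = (\<Sum>x\<in>UNIV. f x * g x * \<pi> x)"


section \<open>Transition semigroup and the associated chain\<close>

primrec gen_pow :: "('a::finite \<Rightarrow> 'a \<Rightarrow> real) \<Rightarrow> nat \<Rightarrow> 'a \<Rightarrow> 'a \<Rightarrow> real" where
  "gen_pow G 0 = (\<lambda>x y. if x = y then 1 else 0)"
| "gen_pow G (Suc n) = (\<lambda>x y. \<Sum>z\<in>UNIV. G x z * gen_pow G n z y)"

text \<open>\<open>P\<^sub>t = exp (t G)\<close>, the matrix exponential taken entrywise.\<close>

definition semigroup_of :: "('a::finite \<Rightarrow> 'a \<Rightarrow> real) \<Rightarrow> real \<Rightarrow> 'a \<Rightarrow> 'a \<Rightarrow> real" where
  "semigroup_of G t x y = (\<Sum>n. t ^ n / fact n * gen_pow G n x y)"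

text \<open>\<open>fdd G s x [(t\<^sub>1,y\<^sub>1),\<dots>,(t\<^sub>n,y\<^sub>n)]\<close> is the probability of being in \<open>y\<^sub>i\<close> at time \<open>t\<^sub>i\<close>
  for all \<open>i\<close>, given the state \<open>x\<close> at time \<open>s\<close>, where \<open>s \<le> t\<^sub>1 \<le> \<dots> \<le> t\<^sub>n\<close>.\<close>

fun fdd :: "('a::finite \<Rightarrow> 'a \<Rightarrow> real) \<Rightarrow> real \<Rightarrow> 'a \<Rightarrow> (real \<times> 'a) list \<Rightarrow> real" where
  "fdd G s x [] = 1"
| "fdd G s x ((t, y) # r) = semigroup_of G (t - s) x y * fdd G t y r"

text \<open>A realisation \<open>(X\<^sub>t)\<close>, \<open>(P\<^sub>x)\<close> of the chain with generator \<open>G\<close>: under \<open>P x\<close> the process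
  is the Markov chain started at \<open>x\<close> (the case \<open>t\<^sub>1 = 0\<close> forces \<open>X 0 = x\<close> almost surely), with
  right-continuous paths for the discrete topology. Only the values \<open>X t\<close> for \<open>t \<ge> 0\<close> matter.\<close>

definition ctmc ::
  "('a::finite \<Rightarrow> 'a \<Rightarrow> real) \<Rightarrow> ('a \<Rightarrow> 'w measure) \<Rightarrow> (real \<Rightarrow> 'w \<Rightarrow> 'a) \<Rightarrow> bool" where
  "ctmc G P X \<longleftrightarrow>
     (\<forall>x. prob_space (P x)) \<and>
     (\<forall>x. \<forall>t\<ge>0. X t \<in> measurable (P x) (count_space UNIV)) \<and>
     (\<forall>x. \<forall>\<omega>\<in>space (P x). \<forall>t\<ge>0. \<exists>\<delta>>0. \<forall>s\<in>{t..<t + \<delta>}. X s \<omega> = X t \<omega>) \<and>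
     (\<forall>x r. sorted (map fst r) \<longrightarrow> (\<forall>(t, y)\<in>set r. 0 \<le> t) \<longrightarrow>
        measure (P x) {\<omega> \<in> space (P x). \<forall>(t, y)\<in>set r. X t \<omega> = y} = fdd G 0 x r)"


section \<open>Hitting times\<close>

text \<open>Times take values in \<^typ>\<open>ennreal\<close>, where the infimum of the empty set is \<open>\<infinity>\<close>.\<close>

definition hit :: "(real \<Rightarrow> 'w \<Rightarrow> 'a) \<Rightarrow> 'a set \<Rightarrow> 'w \<Rightarrow> ennreal" where
  "hit X A \<omega> = Inf {ennreal t | t. 0 \<le> t \<and> X t \<omega> \<in> A}"

definition ret :: "(real \<Rightarrow> 'w \<Rightarrow> 'a) \<Rightarrow> 'a set \<Rightarrow> 'w \<Rightarrow> ennreal" where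
  "ret X A \<omega> =
     Inf {ennreal t | t. 0 < t \<and> X t \<omega> \<in> A \<and> (\<exists>s. 0 < s \<and> s < t \<and> X s \<omega> \<noteq> X 0 \<omega>)}"

text \<open>\<open>exp (- \<lambda> T)\<close> for \<open>\<lambda> > 0\<close>, with value \<open>0\<close> at \<open>T = \<infinity>\<close>.\<close>

definition discount :: "real \<Rightarrow> ennreal \<Rightarrow> real" where
  "discount l T = (if T = \<infinity> then 0 else exp (- (l * enn2real T)))"

definition exp_hit :: "('a \<Rightarrow> 'w measure) \<Rightarrow> (real \<Rightarrow> 'w \<Rightarrow> 'a) \<Rightarrow> 'a \<Rightarrow> 'a set \<Rightarrow> ennreal" where
  "exp_hit P X x A = (\<integral>\<^sup>+ \<omega>. hit X A \<omega> \<partial>P x)"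

text \<open>The chain with initial law \<open>\<pi>\<close> has law \<open>\<Sum>x. \<pi> x \<cdot> P x\<close>; the next two are expectations
  under this mixture.\<close>

definition exp_hit_init ::
  "('a::finite \<Rightarrow> real) \<Rightarrow> ('a \<Rightarrow> 'w measure) \<Rightarrow> (real \<Rightarrow> 'w \<Rightarrow> 'a) \<Rightarrow> 'a set \<Rightarrow> ennreal" where
  "exp_hit_init \<pi> P X A = (\<Sum>x\<in>UNIV. ennreal (\<pi> x) * exp_hit P X x A)"

definition laplace_hit_init ::
  "('a::finite \<Rightarrow> real) \<Rightarrow> ('a \<Rightarrow> 'w measure) \<Rightarrow> (real \<Rightarrow> 'w \<Rightarrow> 'a) \<Rightarrow> real \<Rightarrow> 'a set \<Rightarrow> real" where
  "laplace_hit_init \<pi> P X l A =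
     (\<Sum>x\<in>UNIV. \<pi> x * (\<integral>\<omega>. discount l (hit X A \<omega>) \<partial>P x))"

definition t_com :: "('a \<Rightarrow> 'w measure) \<Rightarrow> (real \<Rightarrow> 'w \<Rightarrow> 'a) \<Rightarrow> 'a \<Rightarrow> 'a \<Rightarrow> ennreal" where
  "t_com P X x y = exp_hit P X x {y} + exp_hit P X y {x}"

definition t_av ::
  "('a::finite \<Rightarrow> real) \<Rightarrow> ('a \<Rightarrow> 'w measure) \<Rightarrow> (real \<Rightarrow> 'w \<Rightarrow> 'a) \<Rightarrow> ennreal" where
  "t_av \<pi> P X =
     (\<Sum>x\<in>UNIV. \<Sum>y\<in>UNIV. exp_hit P X x {y} * ennreal (\<pi> x) * ennreal (\<pi> y))"

text \<open>The holding rate \<open>- G x x\<close> turns the escape probability of the embedded jump chain into a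
  rate of escape, as continuous time requires: with this factor the capacity of a chain reversible
  with respect to \<open>\<pi>\<close> satisfies the Dirichlet principle and, for an irreducible one,
  \<open>t_com x y = 1 / capacity {x} {y}\<close>. Without it, i.e. with \<open>\<pi> x \<cdot> P\<^sub>x (\<dots>)\<close> alone, the quantity
  would ignore the speed of the chain and would not be monotone in the off-diagonal rates.\<close>

definition capacity ::
  "('a::finite \<Rightarrow> 'a \<Rightarrow> real) \<Rightarrow> ('a \<Rightarrow> real) \<Rightarrow> ('a \<Rightarrow> 'w measure) \<Rightarrow> (real \<Rightarrow> 'w \<Rightarrow> 'a) \<Rightarrow>
   'a set \<Rightarrow> 'a set \<Rightarrow> real" where
  "capacity G \<pi> P X A B =
     (\<Sum>x\<in>A. \<pi> x * (- G x x) * measure (P x) {\<omega> \<in> space (P x). ret X A \<omega> > ret X B \<omega>})"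


section \<open>Mixing, spectral gap, asymptotic variance, large deviations\<close>

definition tv_dist :: "('a::finite \<Rightarrow> real) \<Rightarrow> ('a \<Rightarrow> real) \<Rightarrow> real" where
  "tv_dist \<nu> \<pi> = 1 / 2 * (\<Sum>x\<in>UNIV. \<bar>\<nu> x - \<pi> x\<bar>)"

definition t_mix :: "('a::finite \<Rightarrow> 'a \<Rightarrow> real) \<Rightarrow> ('a \<Rightarrow> real) \<Rightarrow> real \<Rightarrow> ennreal" where
  "t_mix G \<pi> e = Inf {ennreal t | t. 0 \<le> t \<and> (SUP x. tv_dist (semigroup_of G t x) \<pi>) < e}"

text \<open>In \<^typ>\<open>ereal\<close> the infimum of the empty set is \<open>\<infinity>\<close> (this occurs for a one-point state
  space) and \<open>1 / 0 = \<infinity>\<close> (this occurs for a reducible chain).\<close>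

definition spectral_gap :: "('a::finite \<Rightarrow> 'a \<Rightarrow> real) \<Rightarrow> ('a \<Rightarrow> real) \<Rightarrow> ereal" where
  "spectral_gap G \<pi> =
     (INF f\<in>{f. mean \<pi> f = 0 \<and> mean \<pi> (\<lambda>x. (f x)\<^sup>2) = 1}.
        ereal (inner_wt \<pi> (\<lambda>x. - gen_app G f x) f))"

definition t_rel :: "('a::finite \<Rightarrow> 'a \<Rightarrow> real) \<Rightarrow> ('a \<Rightarrow> real) \<Rightarrow> ereal" where
  "t_rel G \<pi> = 1 / spectral_gap G \<pi>"

text \<open>For mean-zero \<open>f\<close> the value does not depend on the chosen solution \<open>g\<close> when \<open>G\<close> is
  irreducible or reversible with respect to \<open>\<pi>\<close>. A reducible \<open>G\<close> need not admit a solution; then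
  the variance of the time integral of \<open>f\<close> grows faster than linearly and the value is \<open>\<infinity>\<close>.\<close>

definition asymp_var :: "('a::finite \<Rightarrow> real) \<Rightarrow> ('a \<Rightarrow> 'a \<Rightarrow> real) \<Rightarrow> ('a \<Rightarrow> real) \<Rightarrow> ereal" where
  "asymp_var f G \<pi> =
     (if \<exists>g. gen_app G g = f
      then ereal (- 2 * inner_wt \<pi> f (SOME g. gen_app G g = f))
      else \<infinity>)"

definition ld_rate :: "('a::finite \<Rightarrow> 'a \<Rightarrow> real) \<Rightarrow> ('a \<Rightarrow> real) \<Rightarrow> ereal" where
  "ld_rate G \<nu> =
     (SUP u\<in>{u. \<forall>x. 0 < u x}. ereal (- (\<Sum>x\<in>UNIV. \<nu> x * (gen_app G u x / u x))))"

end

theory Submission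
  imports Defs
begin

text \<open>
  The two Metropolis-Hastings generators are reversible with respect to the same \<open>\<mu>\<close>, and the rates
  off the diagonal satisfy \<open>M\<^sub>1 \<le> M\<^sub>2\<close>. For a reversible \<open>G\<close> the Dirichlet form
  \<open>E(f,f) = \<langle>-G f, f\<rangle> = 1/2 \<Sum> \<mu>(x) G(x,y) (f(x) - f(y))\<^sup>2\<close> contains the off-diagonal rates only,
  each with a nonnegative coefficient; hence \<open>E\<^sub>1 \<le> E\<^sub>2\<close>. Every quantity of the theorem is an
  extremum of an expression in which the form enters with a fixed sign, or is controlled by one,
  and so inherits the order.

  \<^item> The spectral gap is an infimum of \<open>E\<close>.
  \<^item> If \<open>G g = h\<close>, then \<open>-\<langle>h,g\<rangle>\<close> is the maximum over \<open>f\<close> of \<open>-2\<langle>h,f\<rangle> - E(f,f)\<close>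
    (\<open>dual_principle\<close>). This gives the asymptotic variance. It also gives commute times: the
    difference \<open>f = E\<^sub>z(\<tau>\<^sub>y) - E\<^sub>z(\<tau>\<^sub>x)\<close> solves \<open>G f = \<delta>\<^sub>y/\<mu>(y) - \<delta>\<^sub>x/\<mu>(x)\<close>, and the commute time is
    \<open>f(x) - f(y)\<close>.
  \<^item> The large deviation rate at \<open>\<nu>\<close> equals \<open>E(f,f)\<close> with \<open>f = sqrt (\<nu>/\<mu>)\<close>.
  \<^item> The function \<open>u(x) = E\<^sub>x(e\<^sup>-\<^sup>l\<^sup>\<tau>\<^sub>B; \<tau>\<^sub>B < \<tau>\<^sub>A)\<close>, where \<open>l \<ge> 0\<close>, is 1 on \<open>B\<close>, 0 on \<open>A\<close> and solves
    \<open>l u = G u\<close> elsewhere, so it minimises \<open>l \<langle>f,f\<rangle> + E(f,f)\<close> under these boundary values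
    (\<open>dirichlet_principle\<close>). The minimum is \<open>l \<cdot> \<mu>(u)\<close> if \<open>A\<close> is empty and the capacity if \<open>l = 0\<close>.
    Expected hitting times are limits of \<open>(1 - u)/l\<close> as \<open>l \<rightarrow> 0\<close>.
  \<^item> If the first chain is mixed at time \<open>t\<close>, its semigroup at time \<open>t\<close> halves the supremum norm of
    mean-zero functions. After a number of iterations that depends on \<open>min \<mu>\<close> only, the norm of
    \<open>\<ell>\<^sup>2(\<mu>)\<close> is halved as well, and as dissipation is at most \<open>2 E(f,f)\<close> per unit of time this forces a
    Poincare inequality \<open>E\<^sub>1(f,f) \<ge> (c/t) \<langle>f,f\<rangle>\<close>. It passes to \<open>E\<^sub>2\<close> and yields exponential decay
    of the second chain on the time scale \<open>t\<close>.

  The link between the paths and the equation for \<open>u\<close> avoids the strong Markov property. The chain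
  observed on the grid \<open>h, 2h, \<dots>\<close> has a law given by finite-dimensional distributions, so a first
  step decomposition with the kernel \<open>P\<^sub>h\<close> is elementary there. Right-continuity of the paths
  shows that the grid hitting times converge to the true ones as \<open>h \<rightarrow> 0\<close>, while
  \<open>(e\<^sup>-\<^sup>l\<^sup>h P\<^sub>h - I)/h\<close> converges to \<open>G - l\<close>.
\<close>

section \<open>Dirichlet forms of reversible generators\<close>

locale reversible_generator =
  fixes \<mu> :: "'a::finite \<Rightarrow> real" and G :: "'a \<Rightarrow> 'a \<Rightarrow> real"
  assumes weight_pos: "0 < \<mu> x"
    and weight_sum: "(\<Sum>x\<in>UNIV. \<mu> x) = 1"
    and gen: "generator G"
    and detailed_balance: "\<mu> x * G x y = \<mu> y * G y x"
begin

lemma rate_nonneg: "x \<noteq> y \<Longrightarrow> 0 \<le> G x y"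
  using gen by (auto simp: generator_def)

lemma row_sum: "(\<Sum>y\<in>UNIV. G x y) = 0"
  using gen by (auto simp: generator_def)

lemma col_sum: "(\<Sum>x\<in>UNIV. \<mu> x * G x y) = 0"
  using row_sum[of y] by (simp add: detailed_balance[of _ y] sum_distrib_left[symmetric])

definition energy :: "('a \<Rightarrow> real) \<Rightarrow> ('a \<Rightarrow> real) \<Rightarrow> real" where
  "energy f g = inner_wt \<mu> (\<lambda>x. - gen_app G f x) g"

text \<open>This form of the energy no longer contains the diagonal of the generator. Nonnegativity and
  monotonicity in the rates are immediate from it.\<close>

lemma energy_eq:
  "energy f g = (\<Sum>x\<in>UNIV. \<Sum>y\<in>UNIV. \<mu> x * G x y * ((f x - f y) * (g x - g y))) / 2"
proof -
  have e: "energy f g = - (\<Sum>x\<in>UNIV. \<Sum>y\<in>UNIV. \<mu> x * G x y * (f y * g x))"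
    by (simp add: energy_def inner_wt_def gen_app_def sum_distrib_left sum_distrib_right
        sum_negf mult_ac)
  have s: "(\<Sum>x\<in>UNIV. \<Sum>y\<in>UNIV. \<mu> x * G x y * (f x * g y))
      = (\<Sum>x\<in>UNIV. \<Sum>y\<in>UNIV. \<mu> x * G x y * (f y * g x))"
    by (subst sum.swap) (simp add: detailed_balance)
  \<comment> \<open>the diagonal products vanish since rows and, by detailed balance, weighted columns sum to 0\<close>
  have r: "(\<Sum>x\<in>UNIV. \<Sum>y\<in>UNIV. \<mu> x * G x y * (f x * g x)) = 0"
  proof -
    have "(\<Sum>y\<in>UNIV. \<mu> x * G x y * (f x * g x)) = 0" for x
      using row_sum[of x] by (simp flip: sum_distrib_left sum_distrib_right)
    then show ?thesis by simp
  qed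
  have c: "(\<Sum>x\<in>UNIV. \<Sum>y\<in>UNIV. \<mu> x * G x y * (f y * g y)) = 0"
    by (subst sum.swap, simp only: sum_distrib_right[symmetric] col_sum) simp
  show ?thesis
    unfolding e using s r c
    by (simp add: algebra_simps sum.distrib sum_subtractf)
qed

lemma energy_commute: "energy f g = energy g f"
  by (simp add: energy_eq mult_ac)

lemma energy_nonneg: "0 \<le> energy f f"
  unfolding energy_eq
proof (intro divide_nonneg_pos sum_nonneg)
  show "0 \<le> \<mu> x * G x y * ((f x - f y) * (f x - f y))" for x y
    using weight_pos[of x] rate_nonneg[of x y] by (cases "x = y") auto
qed simp

lemma gen_app_diff: "gen_app G (\<lambda>x. f x - g x) x = gen_app G f x - gen_app G g x"
  by (simp add: gen_app_def right_diff_distrib sum_subtractf)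

lemma gen_app_add: "gen_app G (\<lambda>x. f x + g x) x = gen_app G f x + gen_app G g x"
  by (simp add: gen_app_def ring_distribs sum.distrib)

lemma gen_app_cmult: "gen_app G (\<lambda>x. c * f x) x = c * gen_app G f x"
  by (simp add: gen_app_def sum_distrib_left mult_ac)

lemma gen_app_const: "gen_app G (\<lambda>_. c) x = 0"
  using row_sum[of x] by (simp add: gen_app_def flip: sum_distrib_right)

lemma mean_gen_app: "(\<Sum>x\<in>UNIV. \<mu> x * gen_app G f x) = 0"
proof -
  have "(\<Sum>x\<in>UNIV. \<mu> x * gen_app G f x) = (\<Sum>y\<in>UNIV. (\<Sum>x\<in>UNIV. \<mu> x * G x y) * f y)"
    unfolding gen_app_def sum_distrib_left sum_distrib_right
    by (subst sum.swap) (simp add: mult_ac)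
  then show ?thesis by (simp add: col_sum)
qed

lemma energy_diff_right: "energy f (\<lambda>x. g x - k x) = energy f g - energy f k"
  by (simp add: energy_def inner_wt_def right_diff_distrib left_diff_distrib sum_subtractf sum_negf)

lemma energy_diff_self:
  "energy (\<lambda>x. f x - g x) (\<lambda>x. f x - g x) = energy f f - 2 * energy f g + energy g g"
  using energy_diff_right[of "\<lambda>x. f x - g x" f g] energy_diff_right[of f f g]
    energy_diff_right[of g f g] energy_commute[of "\<lambda>x. f x - g x" f]
    energy_commute[of "\<lambda>x. f x - g x" g] energy_commute[of f g] by simp

lemma inner_self_nonneg: "0 \<le> inner_wt \<mu> f f"
  unfolding inner_wt_def using weight_pos by (intro sum_nonneg) (simp add: less_imp_le)

lemma weight_le_inner_self: "(f x)\<^sup>2 * \<mu> x \<le> inner_wt \<mu> f f"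
  unfolding inner_wt_def
  using member_le_sum[of x UNIV "\<lambda>x. f x * f x * \<mu> x"] weight_pos
  by (simp add: power2_eq_square less_imp_le)

text \<open>The equation off \<open>D\<close> says that \<open>u\<close> is orthogonal, for the form \<open>l \<langle>_,_\<rangle> + E\<close>, to every function that
  vanishes on \<open>D\<close>. Thus \<open>f = u + (f - u)\<close> is an orthogonal decomposition. The equation has other
  solutions when the chain is reducible; all of them are minimisers.\<close>

lemma dirichlet_principle:
  assumes "0 \<le> l"
    and eq: "\<And>x. x \<in> D \<Longrightarrow> f x = u x"
    and harm: "\<And>x. x \<notin> D \<Longrightarrow> l * u x = gen_app G u x"
  shows "l * inner_wt \<mu> u u + energy u u \<le> l * inner_wt \<mu> f f + energy f f"
proof -
  let ?d = "\<lambda>x. f x - u x"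
  have "l * inner_wt \<mu> u ?d + energy u ?d
      = (\<Sum>x\<in>UNIV. (l * u x - gen_app G u x) * ?d x * \<mu> x)"
    by (simp add: energy_def inner_wt_def sum_distrib_left algebra_simps sum.distrib sum_subtractf
        sum_negf)
  also have "\<dots> = 0"
    using eq harm by (intro sum.neutral) (metis cancel_comm_monoid_add_class.diff_cancel mult_eq_0_iff)
  finally have orth: "l * inner_wt \<mu> u ?d + energy u ?d = 0" .
  have "inner_wt \<mu> f f = inner_wt \<mu> u u + 2 * inner_wt \<mu> u ?d + inner_wt \<mu> ?d ?d"
    by (simp add: inner_wt_def algebra_simps sum.distrib sum_subtractf sum_distrib_left)
  moreover have "energy f f = energy u u + 2 * energy u ?d + energy ?d ?d"
    using energy_diff_self[of f u] energy_diff_right[of u f u] energy_commute[of f u] by simp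
  moreover have "0 \<le> l * inner_wt \<mu> ?d ?d" using \<open>0 \<le> l\<close> inner_self_nonneg by simp
  ultimately show ?thesis using orth energy_nonneg[of ?d] by (simp add: algebra_simps)
qed

lemma poisson_energy:
  assumes "gen_app G g = h"
  shows "energy g f = - inner_wt \<mu> h f"
  using assms by (auto simp: energy_def inner_wt_def sum_negf)

text \<open>Expand \<open>0 \<le> E(g - f, g - f)\<close>, where \<open>E(g,f) = -\<langle>h,f\<rangle>\<close>. The bound is attained at \<open>f = g\<close>.\<close>

lemma dual_principle:
  assumes "gen_app G g = h"
  shows "- 2 * inner_wt \<mu> h f - energy f f \<le> - inner_wt \<mu> h g"
  using energy_nonneg[of "\<lambda>x. g x - f x"] energy_diff_self[of g f] poisson_energy[OF assms]
  by simp

text \<open>A function without energy is constant across every edge, hence along every path of edges.\<close>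

lemma energy_zero_const:
  assumes irr: "irreducible_gen G" and z: "energy f f = 0"
  shows "f x = f y"
proof -
  have nn: "0 \<le> \<mu> x * G x y * ((f x - f y) * (f x - f y))" for x y
    using weight_pos[of x] rate_nonneg[of x y] by (cases "x = y") auto
  have "(\<Sum>x\<in>UNIV. \<Sum>y\<in>UNIV. \<mu> x * G x y * ((f x - f y) * (f x - f y))) = 0"
    using z by (simp add: energy_eq)
  then have t: "\<mu> x = 0 \<or> G x y = 0 \<or> f x = f y" for x y
    using nn by (simp add: sum_nonneg_eq_0_iff sum_nonneg) blast
  have step: "f u = f v" if "u \<noteq> v" "0 < G u v" for u v
    using t[of u v] weight_pos[of u] that by auto
  have "(x, y) \<in> {(u, v). u \<noteq> v \<and> 0 < G u v}\<^sup>*"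
    using irr by (simp add: irreducible_gen_def)
  then show ?thesis
    by (induction rule: rtrancl_induct) (auto dest: step)
qed

text \<open>On a finite-dimensional space it is enough to invert \<open>f \<mapsto> G f - \<mu>(f)\<close>. This map is injective:
  it changes the mean into its negative, so a function in its kernel has mean zero and is
  harmonic, thus constant. For the same reason the preimage of a mean-zero function has mean zero
  and solves the Poisson equation.\<close>

lemma poisson_solvable:
  assumes irr: "irreducible_gen G" and h: "mean \<mu> h = 0"
  shows "\<exists>g. gen_app G g = h"
proof -
  define L :: "real^'a \<Rightarrow> real^'a"
    where "L v = (\<chi> x. gen_app G (($) v) x - mean \<mu> (($) v))" for v
  have lin: "linear L"
    by (rule linearI)
      (auto simp: L_def vec_eq_iff gen_app_def mean_def algebra_simps sum.distrib sum_distrib_left)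
  have mL: "(\<Sum>x\<in>UNIV. \<mu> x * L v $ x) = - mean \<mu> (($) v)" for v
    using mean_gen_app[of "($) v"] weight_sum
    by (simp add: L_def right_diff_distrib sum_subtractf flip: sum_distrib_right)
  have "inj L"
  proof (rule linear_injective_0[OF lin, THEN iffD2], intro allI impI)
    fix v assume 0: "L v = 0"
    have m: "mean \<mu> (($) v) = 0" using mL[of v] 0 by simp
    have "gen_app G (($) v) x = 0" for x
      using 0 m by (simp add: L_def vec_eq_iff)
    then have "energy (($) v) (($) v) = 0"
      by (simp add: energy_def inner_wt_def)
    then have c: "v $ x = v $ y" for x y using energy_zero_const[OF irr] by blast
    have "v $ x = 0" for x
    proof -
      have "mean \<mu> (($) v) = (\<Sum>y\<in>UNIV. v $ x * \<mu> y)"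
        unfolding mean_def by (intro sum.cong refl) (metis c)
      then show ?thesis using m weight_sum by (simp flip: sum_distrib_left)
    qed
    then show "v = 0" by (simp add: vec_eq_iff)
  qed
  then have "surj L" using lin by (simp add: linear_injective_imp_surjective)
  then obtain v where v: "L v = (\<chi> x. h x)" by (metis surjD)
  have "mean \<mu> (($) v) = 0" using mL[of v] h by (simp add: v mean_def mult_ac)
  then have "gen_app G (($) v) = h" using v by (auto simp: L_def vec_eq_iff)
  then show ?thesis by blast
qed


text \<open>Symmetrising the double sum by detailed balance pairs the terms of \<open>(x,y)\<close> and \<open>(y,x)\<close>, and
  \<open>f(x)\<^sup>2 u(y)/u(x) + f(y)\<^sup>2 u(x)/u(y) \<ge> 2 f(x) f(y)\<close>.\<close>

lemma ld_functional_le_energy: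
  assumes nu: "\<And>x. \<nu> x = \<mu> x * (f x)\<^sup>2" and u: "\<And>x. 0 < u x"
  shows "- (\<Sum>x\<in>UNIV. \<nu> x * (gen_app G u x / u x)) \<le> energy f f"
proof -
  let ?w = "\<lambda>x y. \<mu> x * G x y"
  let ?r = "\<lambda>x y. (f x)\<^sup>2 * (u y / u x)"
  have "(\<Sum>x\<in>UNIV. \<nu> x * (gen_app G u x / u x)) = (\<Sum>x\<in>UNIV. \<Sum>y\<in>UNIV. ?w x y * ?r x y)"
    by (simp add: nu gen_app_def sum_divide_distrib sum_distrib_left mult_ac)
  moreover have "(\<Sum>x\<in>UNIV. \<Sum>y\<in>UNIV. ?w x y * ?r x y) = (\<Sum>x\<in>UNIV. \<Sum>y\<in>UNIV. ?w x y * ?r y x)"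
    by (subst sum.swap) (simp add: detailed_balance)
  ultimately have "2 * (\<Sum>x\<in>UNIV. \<nu> x * (gen_app G u x / u x))
      = (\<Sum>x\<in>UNIV. \<Sum>y\<in>UNIV. ?w x y * (?r x y + ?r y x))"
    by (simp add: distrib_left sum.distrib)
  moreover have "(\<Sum>x\<in>UNIV. \<Sum>y\<in>UNIV. ?w x y * (2 * (f x * f y))) 
      \<le> (\<Sum>x\<in>UNIV. \<Sum>y\<in>UNIV. ?w x y * (?r x y + ?r y x))"
  proof (intro sum_mono)
    fix x y
    show "?w x y * (2 * (f x * f y)) \<le> ?w x y * (?r x y + ?r y x)"
    proof (cases "x = y")
      case True
      then show ?thesis using u[of x] by (simp add: power2_eq_square)
    next
      case False
      have p: "0 < sqrt (u y / u x)" using u by simp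
      have i: "sqrt (u x / u y) = 1 / sqrt (u y / u x)" by (simp add: real_sqrt_divide)
      have "0 \<le> (f x * sqrt (u y / u x) - f y * sqrt (u x / u y))\<^sup>2" by simp
      also have "\<dots> = ?r x y + ?r y x - 2 * (f x * f y)"
        using u[of x] u[of y] p
        by (simp add: power2_diff power_mult_distrib less_imp_le i power_divide)
      finally show ?thesis
        using weight_pos[of x] rate_nonneg[OF False] by (intro mult_left_mono) auto
    qed
  qed
  moreover have "energy f f = - (\<Sum>x\<in>UNIV. \<Sum>y\<in>UNIV. ?w x y * (f x * f y))"
    by (simp add: energy_def inner_wt_def gen_app_def sum_distrib_left sum_distrib_right
        sum_negf mult_ac)
  moreover have "(\<Sum>x\<in>UNIV. \<Sum>y\<in>UNIV. ?w x y * (2 * (f x * f y)))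
      = 2 * (\<Sum>x\<in>UNIV. \<Sum>y\<in>UNIV. ?w x y * (f x * f y))"
    by (simp add: sum_distrib_left mult_ac)
  ultimately show ?thesis by linarith
qed

text \<open>The optimal test function is \<open>f\<close> itself, which may vanish at some states; \<open>f + e\<close> with \<open>e > 0\<close> is
  admissible and approaches the optimum as \<open>e \<rightarrow> 0\<close>.\<close>

lemma energy_le_ld_rate:
  assumes nu: "\<And>x. \<nu> x = \<mu> x * (f x)\<^sup>2" and f: "\<And>x. 0 \<le> f x"
  shows "ereal (energy f f) \<le> ld_rate G \<nu>"
proof -
  define J where "J e = - (\<Sum>x\<in>UNIV. \<nu> x * (gen_app G (\<lambda>y. f y + e) x / (f x + e)))" for e
  have "((\<lambda>e. \<nu> x * (gen_app G (\<lambda>y. f y + e) x / (f x + e)))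
      \<longlongrightarrow> f x * gen_app G f x * \<mu> x) (at_right 0)" for x
  proof (cases "f x = 0")
    case True
    then show ?thesis by (simp add: nu)
  next
    case False
    have "((\<lambda>e. \<nu> x * (gen_app G f x / (f x + e)))
      \<longlongrightarrow> \<nu> x * (gen_app G f x / (f x + 0))) (at_right 0)"
      using False by (intro tendsto_intros) auto
    then show ?thesis using False
      by (simp add: nu gen_app_add gen_app_const power2_eq_square mult_ac)
  qed
  then have "(J \<longlongrightarrow> - (\<Sum>x\<in>UNIV. f x * gen_app G f x * \<mu> x)) (at_right 0)"
    unfolding J_def by (intro tendsto_minus tendsto_sum)
  then have "(J \<longlongrightarrow> energy f f) (at_right 0)"
    by (simp add: energy_def inner_wt_def sum_negf mult_ac)
  then have "((\<lambda>e. ereal (J e)) \<longlongrightarrow> ereal (energy f f)) (at_right 0)" by simp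
  moreover have "\<forall>\<^sub>F e in at_right 0. ereal (J e) \<le> ld_rate G \<nu>"
    unfolding eventually_at_right_field
  proof (intro exI[of _ 1] conjI allI impI)
    fix e :: real assume "0 < e" "e < 1"
    then have "\<forall>x. 0 < f x + e" using f by (simp add: add_nonneg_pos)
    then show "ereal (J e) \<le> ld_rate G \<nu>"
      unfolding ld_rate_def J_def by (intro SUP_upper2[of "\<lambda>y. f y + e"]) auto
  qed simp
  ultimately show ?thesis
    using tendsto_upperbound by (metis trivial_limit_at_right_real)
qed

end

section \<open>Two reversible generators with ordered rates\<close>

locale ordered_generators =
  slow: reversible_generator \<mu> M1 + fast: reversible_generator \<mu> M2
  for \<mu> :: "'a::finite \<Rightarrow> real" and M1 M2 :: "'a \<Rightarrow> 'a \<Rightarrow> real" +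
  assumes rate_le: "x \<noteq> y \<Longrightarrow> M1 x y \<le> M2 x y"
begin

lemma energy_le: "slow.energy f f \<le> fast.energy f f"
  unfolding slow.energy_eq fast.energy_eq
proof (intro divide_right_mono sum_mono)
  show "\<mu> x * M1 x y * ((f x - f y) * (f x - f y)) \<le> \<mu> x * M2 x y * ((f x - f y) * (f x - f y))"
    for x y
    using slow.weight_pos[of x] rate_le[of x y]
    by (cases "x = y") (auto intro!: mult_right_mono mult_left_mono)
qed simp

lemma spectral_gap_le: "spectral_gap M1 \<mu> \<le> spectral_gap M2 \<mu>"
  unfolding spectral_gap_def
  using energy_le by (intro INF_mono) (auto simp: slow.energy_def fast.energy_def)

lemma t_rel_ge: "t_rel M2 \<mu> \<le> t_rel M1 \<mu>"
proof -
  \<comment> \<open>inversion is antitone on nonnegative extended reals only, since \<open>1 / 0 = \<infinity>\<close>\<close>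
  have "0 \<le> spectral_gap M1 \<mu>"
    unfolding spectral_gap_def using slow.energy_nonneg
    by (intro INF_greatest) (auto simp: slow.energy_def)
  then show ?thesis
    unfolding t_rel_def divide_ereal_def using spectral_gap_le
    by (simp add: ereal_inverse_antimono)
qed

text \<open>The solution for the faster generator serves as a test function in the dual principle of the slower
  one; passing to the smaller form only increases the value.\<close>

lemma poisson_inner_le:
  assumes "gen_app M1 g1 = h" "gen_app M2 g2 = h"
  shows "- inner_wt \<mu> h g2 \<le> - inner_wt \<mu> h g1"
  using slow.dual_principle[OF assms(1), of g2] fast.poisson_energy[OF assms(2), of g2]
    energy_le[of g2] by simp

lemma asymp_var_ge:
  assumes irr: "irreducible_gen M2" and h: "mean \<mu> h = 0"
  shows "asymp_var h M2 \<mu> \<le> asymp_var h M1 \<mu>"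
proof (cases "\<exists>g. gen_app M1 g = h")
  case True
  then have 1: "gen_app M1 (SOME g. gen_app M1 g = h) = h" by (rule someI_ex)
  have ex: "\<exists>g. gen_app M2 g = h" using fast.poisson_solvable[OF irr h] .
  then have 2: "gen_app M2 (SOME g. gen_app M2 g = h) = h" by (rule someI_ex)
  show ?thesis using poisson_inner_le[OF 1 2] True ex by (simp add: asymp_var_def)
qed (simp add: asymp_var_def)

lemma ld_rate_le:
  assumes "\<And>x. 0 \<le> \<nu> x"
  shows "ld_rate M1 \<nu> \<le> ld_rate M2 \<nu>"
proof -
  define f where "f x = sqrt (\<nu> x / \<mu> x)" for x
  have nu: "\<nu> x = \<mu> x * (f x)\<^sup>2" and f: "0 \<le> f x" for x
    using assms[of x] slow.weight_pos[of x] by (auto simp: f_def less_imp_le)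
  have "ld_rate M1 \<nu> \<le> ereal (slow.energy f f)"
    unfolding ld_rate_def
    using slow.ld_functional_le_energy[of \<nu> f, OF nu] by (intro SUP_least) auto
  also have "\<dots> \<le> ereal (fast.energy f f)" using energy_le by simp
  also have "\<dots> \<le> ld_rate M2 \<nu>" using fast.energy_le_ld_rate nu f by blast
  finally show ?thesis .
qed

end

section \<open>The semigroup and its mixing time\<close>

text \<open>Geometric growth of the matrix powers makes the exponential series converge everywhere and
  allows termwise differentiation.\<close>

lemma gen_pow_bound: "\<exists>K. 0 \<le> K \<and> (\<forall>n x y. \<bar>gen_pow G n x y\<bar> \<le> K ^ n)"
proof (intro exI conjI allI)
  define K where "K = (\<Sum>x\<in>UNIV. \<Sum>y\<in>UNIV. \<bar>G x y\<bar>)"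
  show K0: "0 \<le> K" by (simp add: K_def sum_nonneg)
  fix n x y
  show "\<bar>gen_pow G n x y\<bar> \<le> K ^ n"
  proof (induction n arbitrary: x)
    case (Suc n)
    have "\<bar>gen_pow G (Suc n) x y\<bar> \<le> (\<Sum>z\<in>UNIV. \<bar>G x z\<bar> * \<bar>gen_pow G n z y\<bar>)"
      by (simp add: sum_abs flip: abs_mult)
    also have "\<dots> \<le> (\<Sum>z\<in>UNIV. \<bar>G x z\<bar> * K ^ n)"
      using Suc by (intro sum_mono mult_left_mono) auto
    also have "\<dots> = (\<Sum>z\<in>UNIV. \<bar>G x z\<bar>) * K ^ n" by (simp add: sum_distrib_right)
    also have "\<dots> \<le> K * K ^ n"
      unfolding K_def
      by (intro mult_right_mono zero_le_power sum_nonneg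
          member_le_sum[of x UNIV "\<lambda>x. \<Sum>z\<in>UNIV. \<bar>G x z\<bar>"]) auto
    finally show ?case by simp
  qed simp
qed

lemma semigroup_series_summable: "summable (\<lambda>n. gen_pow G n x y / fact n * t ^ n)"
proof -
  obtain K where K: "0 \<le> K" "\<And>n x y. \<bar>gen_pow G n x y\<bar> \<le> K ^ n"
    using gen_pow_bound by blast
  show ?thesis
  proof (rule summable_comparison_test)
    show "summable (\<lambda>n. (K * \<bar>t\<bar>) ^ n /\<^sub>R fact n)" by (rule summable_exp_generic)
    show "\<exists>N. \<forall>n\<ge>N. norm (gen_pow G n x y / fact n * t ^ n) \<le> (K * \<bar>t\<bar>) ^ n /\<^sub>R fact n"
      using K mult_right_mono[OF K(2), of "\<bar>t\<bar> ^ n" for n]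
      by (intro exI[of _ 0] allI impI)
        (simp add: abs_mult power_abs power_mult_distrib divide_inverse mult_ac)
  qed
qed

lemma semigroup_of_DERIV:
  "((\<lambda>t. semigroup_of G t x y) has_real_derivative (\<Sum>z\<in>UNIV. G x z * semigroup_of G t z y)) (at t)"
proof -
  let ?c = "\<lambda>x n. gen_pow G n x y / fact n"
  have eq: "semigroup_of G t x y = (\<Sum>n. ?c x n * t ^ n)" for t x
    by (simp add: semigroup_of_def mult_ac)
  have "diffs (?c x) n * t ^ n = (\<Sum>z\<in>UNIV. G x z * (?c z n * t ^ n))" for n
  proof -
    have "diffs (?c x) n = gen_pow G (Suc n) x y / fact n"
      by (simp add: diffs_def fact_Suc del: gen_pow.simps of_nat_Suc)
    then show ?thesis by (simp add: sum_divide_distrib sum_distrib_left sum_distrib_right mult_ac)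
  qed
  then have "(\<Sum>n. diffs (?c x) n * t ^ n) = (\<Sum>n. \<Sum>z\<in>UNIV. G x z * (?c z n * t ^ n))"
    by simp
  also have "\<dots> = (\<Sum>z\<in>UNIV. \<Sum>n. G x z * (?c z n * t ^ n))"
    by (intro suminf_sum summable_mult semigroup_series_summable)
  also have "\<dots> = (\<Sum>z\<in>UNIV. G x z * (\<Sum>n. ?c z n * t ^ n))"
    by (intro sum.cong refl suminf_mult semigroup_series_summable)
  finally have "(\<Sum>n. diffs (?c x) n * t ^ n) = (\<Sum>z\<in>UNIV. G x z * (\<Sum>n. ?c z n * t ^ n))" .
  moreover have "((\<lambda>t. \<Sum>n. ?c x n * t ^ n) has_real_derivative (\<Sum>n. diffs (?c x) n * t ^ n)) (at t)"
    by (rule termdiffs_strong_converges_everywhere[OF semigroup_series_summable])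
  ultimately show ?thesis by (simp add: eq)
qed

lemma semigroup_of_0: "semigroup_of G 0 x y = (if x = y then 1 else 0)"
proof -
  have "semigroup_of G 0 x y = (\<Sum>n. (gen_pow G n x y / fact n) * 0 ^ n)"
    by (simp add: semigroup_of_def mult_ac)
  then show ?thesis by (simp only: powser_zero) simp
qed

definition flow :: "('a::finite \<Rightarrow> 'a \<Rightarrow> real) \<Rightarrow> ('a \<Rightarrow> real) \<Rightarrow> real \<Rightarrow> 'a \<Rightarrow> real" where
  "flow G f t x = (\<Sum>y\<in>UNIV. semigroup_of G t x y * f y)"

lemma flow_DERIV: "((\<lambda>t. flow G f t x) has_real_derivative gen_app G (flow G f t) x) (at t)"
proof -
  have "((\<lambda>t. flow G f t x) has_real_derivative
      (\<Sum>y\<in>UNIV. (\<Sum>z\<in>UNIV. G x z * semigroup_of G t z y) * f y)) (at t)"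
    unfolding flow_def
    by (intro DERIV_sum DERIV_cmult_right semigroup_of_DERIV)
  also have "(\<Sum>y\<in>UNIV. (\<Sum>z\<in>UNIV. G x z * semigroup_of G t z y) * f y) = gen_app G (flow G f t) x"
    unfolding gen_app_def flow_def sum_distrib_left sum_distrib_right
    by (subst sum.swap) (simp add: mult_ac)
  finally show ?thesis .
qed

lemma flow_0: "flow G f 0 x = f x"
  by (simp add: flow_def semigroup_of_0 if_distrib[of "\<lambda>c. c * _"] cong: if_cong)

context reversible_generator
begin

lemma inner_self_DERIV:
  assumes "\<And>x. ((\<lambda>t. v t x) has_real_derivative gen_app G (v t) x) (at t)"
  shows "((\<lambda>t. inner_wt \<mu> (v t) (v t)) has_real_derivative - 2 * energy (v t) (v t)) (at t)"
proof -
  have "((\<lambda>t. inner_wt \<mu> (v t) (v t)) has_real_derivative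
      (\<Sum>x\<in>UNIV. (gen_app G (v t) x * v t x + gen_app G (v t) x * v t x) * \<mu> x)) (at t)"
    unfolding inner_wt_def by (intro DERIV_sum DERIV_cmult_right DERIV_mult assms)
  also have "(\<Sum>x\<in>UNIV. (gen_app G (v t) x * v t x + gen_app G (v t) x * v t x) * \<mu> x)
      = - 2 * energy (v t) (v t)"
    by (simp add: energy_def inner_wt_def sum_negf sum_distrib_left algebra_simps)
  finally show ?thesis .
qed

text \<open>The derivative of \<open>\<langle>v,v\<rangle>\<close> along the flow is \<open>-2 E(v,v) \<le> 0\<close>. This uniqueness statement replaces a
  product formula for exponential series: the semigroup law and the conservation of constants
  follow from it.\<close>

lemma generator_ode_zero:
  assumes d: "\<And>x t. ((\<lambda>t. v t x) has_real_derivative gen_app G (v t) x) (at t)"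
    and 0: "\<And>x. v 0 x = 0" and t: "0 \<le> t"
  shows "v t x = 0"
proof -
  have "inner_wt \<mu> (v t) (v t) \<le> inner_wt \<mu> (v 0) (v 0)"
  proof (rule DERIV_nonpos_imp_nonincreasing[OF t])
    fix s
    have "- 2 * energy (v s) (v s) \<le> 0" using energy_nonneg[of "v s"] by simp
    then show "\<exists>y. ((\<lambda>t. inner_wt \<mu> (v t) (v t)) has_real_derivative y) (at s) \<and> y \<le> 0"
      using inner_self_DERIV[OF d] by blast
  qed
  also have "\<dots> = 0" using 0 by (simp add: inner_wt_def)
  finally have "(v t x)\<^sup>2 * \<mu> x \<le> 0" using weight_le_inner_self[of "v t" x] by linarith
  then show ?thesis using weight_pos[of x] by (simp add: mult_le_0_iff)
qed

lemma flow_const: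
  assumes "0 \<le> t" shows "flow G (\<lambda>_. c) t x = c"
proof -
  have "flow G (\<lambda>_. c) t x - c = 0"
  proof (rule generator_ode_zero[where v = "\<lambda>t x. flow G (\<lambda>_. c) t x - c"])
    fix x t
    have "((\<lambda>t. flow G (\<lambda>_. c) t x - c) has_real_derivative gen_app G (flow G (\<lambda>_. c) t) x - 0) (at t)"
      by (intro DERIV_diff flow_DERIV DERIV_const)
    then show "((\<lambda>t. flow G (\<lambda>_. c) t x - c) has_real_derivative
        gen_app G (\<lambda>x. flow G (\<lambda>_. c) t x - c) x) (at t)"
      by (simp add: gen_app_diff gen_app_const)
  qed (use assms in \<open>auto simp: flow_0\<close>)
  then show ?thesis by simp
qed

lemma flow_add:
  assumes "0 \<le> t" shows "flow G f (s + t) x = flow G (flow G f s) t x"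
proof -
  have "flow G f (s + t) x - flow G (flow G f s) t x = 0"
  proof (rule generator_ode_zero[where v = "\<lambda>t x. flow G f (s + t) x - flow G (flow G f s) t x"])
    fix x t
    have "((\<lambda>t. flow G f (s + t) x) has_real_derivative gen_app G (flow G f (s + t)) x) (at t)"
      using DERIV_chain2[where f = "\<lambda>t. flow G f t x" and g = "\<lambda>t. s + t" and x = t,
          OF flow_DERIV DERIV_add[OF DERIV_const DERIV_ident]] by simp
    then show "((\<lambda>t. flow G f (s + t) x - flow G (flow G f s) t x) has_real_derivative
        gen_app G (\<lambda>x. flow G f (s + t) x - flow G (flow G f s) t x) x) (at t)"
      by (simp add: gen_app_diff DERIV_diff flow_DERIV)
  qed (use assms in \<open>auto simp: flow_0\<close>)
  then show ?thesis by simp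
qed

lemma mean_flow:
  shows "mean \<mu> (flow G f t) = mean \<mu> f"
proof -
  have "mean \<mu> (flow G f t) = mean \<mu> (flow G f 0)"
  proof (rule DERIV_isconst_all[where f = "\<lambda>t. mean \<mu> (flow G f t)"], intro allI)
    fix t
    have "((\<lambda>t. mean \<mu> (flow G f t)) has_real_derivative (\<Sum>x\<in>UNIV. gen_app G (flow G f t) x * \<mu> x)) (at t)"
      unfolding mean_def by (intro DERIV_sum DERIV_cmult_right flow_DERIV)
    then show "((\<lambda>t. mean \<mu> (flow G f t)) has_real_derivative 0) (at t)"
      using mean_gen_app[of "flow G f t"] by (simp add: mult.commute)
  qed
  then show ?thesis by (simp add: mean_def flow_0)
qed

text \<open>Along the flow the derivative of \<open>E(v,v)\<close> is \<open>2 E(v, G v) = -2 \<langle>G v, G v\<rangle>\<close>.\<close>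

lemma energy_flow_antimono:
  assumes "0 \<le> t" shows "energy (flow G f t) (flow G f t) \<le> energy f f"
proof -
  let ?v = "flow G f"
  have "energy (?v t) (?v t) \<le> energy (?v 0) (?v 0)"
  proof (rule DERIV_nonpos_imp_nonincreasing[OF assms])
    fix s
    let ?g = "gen_app G (?v s)"
    have "((\<lambda>t. energy (?v t) (?v t)) has_real_derivative
        (\<Sum>x\<in>UNIV. \<Sum>y\<in>UNIV. \<mu> x * G x y *
          ((?g x - ?g y) * (?v s x - ?v s y) + (?g x - ?g y) * (?v s x - ?v s y))) / 2) (at s)"
      unfolding energy_eq
      by (intro DERIV_cdivide DERIV_sum DERIV_cmult DERIV_mult DERIV_diff flow_DERIV)
    also have "(\<Sum>x\<in>UNIV. \<Sum>y\<in>UNIV. \<mu> x * G x y *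
          ((?g x - ?g y) * (?v s x - ?v s y) + (?g x - ?g y) * (?v s x - ?v s y))) / 2
        = 2 * energy (?v s) ?g"
      by (simp add: energy_eq sum_distrib_left sum_divide_distrib algebra_simps)
    also have "energy (?v s) ?g = - inner_wt \<mu> ?g ?g"
      by (simp add: energy_def inner_wt_def sum_negf)
    finally show "\<exists>y. ((\<lambda>t. energy (?v t) (?v t)) has_real_derivative y) (at s) \<and> y \<le> 0"
      using inner_self_nonneg[of ?g] by (intro exI conjI) auto
  qed
  moreover have "?v 0 = f" by (simp add: flow_0 fun_eq_iff)
  ultimately show ?thesis by simp
qed

text \<open>The loss rate of \<open>\<langle>v,v\<rangle>\<close> is \<open>2 E(v,v)\<close>, which is largest at time 0.\<close>

lemma flow_dissipation_le:
  assumes "0 \<le> t"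
  shows "inner_wt \<mu> f f - inner_wt \<mu> (flow G f t) (flow G f t) \<le> 2 * t * energy f f"
proof -
  let ?v = "flow G f"
  let ?\<phi> = "\<lambda>t. inner_wt \<mu> (?v t) (?v t) + t * (2 * energy f f)"
  have "?\<phi> 0 \<le> ?\<phi> t"
  proof (rule DERIV_nonneg_imp_nondecreasing[OF assms])
    fix s :: real assume s: "0 \<le> s"
    have "(?\<phi> has_real_derivative - 2 * energy (?v s) (?v s) + 2 * energy f f) (at s)"
      by (auto intro!: derivative_eq_intros inner_self_DERIV flow_DERIV)
    then show "\<exists>y. (?\<phi> has_real_derivative y) (at s) \<and> 0 \<le> y"
      using energy_flow_antimono[OF s, of f] by (intro exI conjI) auto
  qed
  moreover have "?v 0 = f" by (simp add: flow_0 fun_eq_iff)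
  ultimately show ?thesis by simp
qed

lemma flow_exp_decay:
  assumes gap: "\<And>f. mean \<mu> f = 0 \<Longrightarrow> k * inner_wt \<mu> f f \<le> energy f f"
    and f: "mean \<mu> f = 0" and t: "0 \<le> t"
  shows "inner_wt \<mu> (flow G f t) (flow G f t) \<le> exp (- 2 * k * t) * inner_wt \<mu> f f"
proof -
  let ?v = "flow G f"
  let ?\<phi> = "\<lambda>t. exp (2 * k * t) * inner_wt \<mu> (?v t) (?v t)"
  have "?\<phi> t \<le> ?\<phi> 0"
  proof (rule DERIV_nonpos_imp_nonincreasing[OF t])
    fix s
    have "(?\<phi> has_real_derivative
        exp (2 * k * s) * (2 * (k * inner_wt \<mu> (?v s) (?v s) - energy (?v s) (?v s)))) (at s)"
      by (auto intro!: derivative_eq_intros inner_self_DERIV flow_DERIV simp: algebra_simps)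
    moreover have "exp (2 * k * s) * (2 * (k * inner_wt \<mu> (?v s) (?v s) - energy (?v s) (?v s))) \<le> 0"
      using gap[of "?v s"] f by (simp add: mean_flow mult_le_0_iff)
    ultimately show "\<exists>y. (?\<phi> has_real_derivative y) (at s) \<and> y \<le> 0" by blast
  qed
  moreover have "?v 0 = f" by (simp add: flow_0 fun_eq_iff)
  ultimately show ?thesis by (simp add: exp_minus field_simps)
qed

lemma mean_square_le:
  "inner_wt \<mu> (\<lambda>x. f x - mean \<mu> f) (\<lambda>x. f x - mean \<mu> f) \<le> inner_wt \<mu> f f"
proof -
  let ?m = "mean \<mu> f"
  have "inner_wt \<mu> (\<lambda>x. f x - ?m) (\<lambda>x. f x - ?m)
      = inner_wt \<mu> f f - 2 * ?m * (\<Sum>x\<in>UNIV. f x * \<mu> x) + ?m\<^sup>2 * (\<Sum>x\<in>UNIV. \<mu> x)"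
    by (simp add: inner_wt_def sum_distrib_left algebra_simps power2_eq_square sum.distrib
        sum_subtractf)
  also have "\<dots> = inner_wt \<mu> f f - ?m\<^sup>2"
    by (simp add: weight_sum mean_def power2_eq_square)
  finally show ?thesis by simp
qed

text \<open>Subtracting the mean, which is 0, exposes the signed measure whose mass is twice the total
  variation distance.\<close>

lemma flow_eq_tv:
  assumes "mean \<mu> f = 0"
  shows "flow G f t x = (\<Sum>y\<in>UNIV. (semigroup_of G t x y - \<mu> y) * f y)"
  using assms by (simp add: flow_def mean_def algebra_simps sum_subtractf)

lemma flow_halves:
  assumes tv: "\<And>x. tv_dist (semigroup_of G t x) \<mu> < 1 / 4"
    and f: "mean \<mu> f = 0" and b: "\<And>x. \<bar>f x\<bar> \<le> b"
  shows "\<bar>flow G f t x\<bar> \<le> b / 2"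
proof -
  have b0: "0 \<le> b" using b[of undefined] by linarith
  have "\<bar>flow G f t x\<bar> \<le> (\<Sum>y\<in>UNIV. \<bar>semigroup_of G t x y - \<mu> y\<bar> * \<bar>f y\<bar>)"
    unfolding flow_eq_tv[OF f] by (simp add: sum_abs flip: abs_mult)
  also have "\<dots> \<le> (\<Sum>y\<in>UNIV. \<bar>semigroup_of G t x y - \<mu> y\<bar> * b)"
    using b by (intro sum_mono mult_left_mono) auto
  also have "\<dots> = 2 * tv_dist (semigroup_of G t x) \<mu> * b"
    by (simp add: tv_dist_def sum_distrib_right)
  also have "\<dots> \<le> (1 / 2) * b"
    using tv[of x] b0 by (intro mult_right_mono) auto
  finally show ?thesis by simp
qed

lemma flow_halves_iter:
  assumes tv: "\<And>x. tv_dist (semigroup_of G t x) \<mu> < 1 / 4" and t: "0 \<le> t"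
    and f: "mean \<mu> f = 0" and b: "\<And>x. \<bar>f x\<bar> \<le> b"
  shows "\<bar>flow G f (n * t) x\<bar> \<le> b / 2 ^ n"
proof (induction n arbitrary: x)
  case (Suc n)
  have "flow G f (real (Suc n) * t) x = flow G (flow G f (n * t)) t x"
    using flow_add[OF t, of f "n * t" x] by (simp add: algebra_simps)
  then show ?case using flow_halves[OF tv, of "flow G f (n * t)" "b / 2 ^ n" x] Suc f
    by (simp add: mean_flow field_simps)
qed (use b in \<open>simp add: flow_0\<close>)

text \<open>After \<open>n\<close> rounds of length \<open>t\<close> the supremum norm has dropped by the factor \<open>2\<^sup>-\<^sup>n\<close>. Passing between the supremum
  norm and the norm of \<open>\<ell>\<^sup>2(\<mu>)\<close> costs \<open>1/m\<close> for the squares, which the choice of \<open>n\<close> absorbs up to a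
  factor \<open>1/4\<close>. The remaining \<open>3/4\<close> of \<open>\<langle>f,f\<rangle>\<close> has been dissipated within time \<open>n t\<close>.\<close>

lemma poincare_of_mixing:
  assumes tv: "\<And>x. tv_dist (semigroup_of G t x) \<mu> < 1 / 4" and t: "0 \<le> t"
    and f: "mean \<mu> f = 0" and m: "\<And>x. m \<le> \<mu> x" and n: "4 \<le> m * 4 ^ n"
  shows "3 / 4 * inner_wt \<mu> f f \<le> 2 * (n * t) * energy f f"
proof -
  define b where "b = Max (range (\<lambda>x. \<bar>f x\<bar>))"
  have b: "\<bar>f x\<bar> \<le> b" for x by (simp add: b_def)
  have "b \<in> range (\<lambda>x. \<bar>f x\<bar>)" unfolding b_def by (rule Max_in) auto
  then obtain z where z: "b = \<bar>f z\<bar>" by blast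
  have "b\<^sup>2 * m \<le> inner_wt \<mu> f f"
    using weight_le_inner_self[of f z] m[of z] mult_left_mono[OF m[of z], of "b\<^sup>2"] z by simp
  moreover have "4 * b\<^sup>2 \<le> b\<^sup>2 * m * 4 ^ n"
    using mult_left_mono[OF n, of "b\<^sup>2"] by (simp add: mult_ac)
  ultimately have b4: "4 * b\<^sup>2 \<le> inner_wt \<mu> f f * 4 ^ n"
    by (meson mult_right_mono order_trans zero_le_numeral zero_le_power)
  let ?g = "flow G f (n * t)"
  have "(?g x)\<^sup>2 \<le> (b / 2 ^ n)\<^sup>2" for x
    using power_mono[OF flow_halves_iter[where n = n and x = x, OF tv t f b] abs_ge_zero, of 2]
    by simp
  then have "inner_wt \<mu> ?g ?g \<le> (\<Sum>x\<in>UNIV. (b / 2 ^ n)\<^sup>2 * \<mu> x)"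
    unfolding inner_wt_def using weight_pos
    by (intro sum_mono mult_right_mono) (auto simp: power2_eq_square less_imp_le)
  also have "\<dots> = (b / 2 ^ n)\<^sup>2"
    by (simp only: sum_distrib_left[symmetric] weight_sum mult_1_right)
  also have "\<dots> = b\<^sup>2 / 4 ^ n"
  proof -
    have "(2::real) ^ n * 2 ^ n = 4 ^ n" by (simp flip: power_mult_distrib)
    then show ?thesis by (simp add: power2_eq_square)
  qed
  also have "\<dots> \<le> inner_wt \<mu> f f / 4" using b4 by (simp add: field_simps)
  finally show ?thesis using flow_dissipation_le[of "n * t" f] t by simp
qed

text \<open>The total variation distance is dual to the supremum norm: test against the sign of the
  difference, centred so that the \<open>\<ell>\<^sup>2\<close> decay applies.\<close>

lemma tv_le_exp:
  assumes gap: "\<And>f. mean \<mu> f = 0 \<Longrightarrow> k * inner_wt \<mu> f f \<le> energy f f"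
    and t: "0 \<le> t" and m: "\<And>x. m \<le> \<mu> x" "0 < m"
  shows "tv_dist (semigroup_of G t x) \<mu> \<le> exp (- k * t) / sqrt m / 2"
proof -
  let ?p = "\<lambda>y. semigroup_of G t x y - \<mu> y"
  define e where "e y = sgn (?p y)" for y
  define f where "f y = e y - mean \<mu> e" for y
  have mf: "mean \<mu> f = 0"
    by (simp add: f_def mean_def left_diff_distrib sum_subtractf weight_sum flip: sum_distrib_left)
  have p0: "(\<Sum>y\<in>UNIV. ?p y) = 0"
    using flow_const[OF t, of 1 x] by (simp add: flow_def sum_subtractf weight_sum)
  have "(\<Sum>y\<in>UNIV. \<bar>?p y\<bar>) = (\<Sum>y\<in>UNIV. ?p y * e y)"
    by (simp add: e_def abs_sgn)
  also have "\<dots> = (\<Sum>y\<in>UNIV. ?p y * f y)"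
    using p0 by (simp add: f_def right_diff_distrib sum_subtractf flip: sum_distrib_right)
  also have "\<dots> = flow G f t x" using flow_eq_tv[OF mf] by simp
  finally have eq: "(\<Sum>y\<in>UNIV. \<bar>?p y\<bar>) = flow G f t x" .
  have "inner_wt \<mu> f f \<le> inner_wt \<mu> e e" unfolding f_def by (rule mean_square_le)
  also have "\<dots> \<le> (\<Sum>y\<in>UNIV. \<mu> y)"
    unfolding inner_wt_def e_def using weight_pos
    by (intro sum_mono) (auto simp: sgn_if less_imp_le)
  finally have f1: "inner_wt \<mu> f f \<le> 1" by (simp add: weight_sum)
  have "(flow G f t x)\<^sup>2 * m \<le> (flow G f t x)\<^sup>2 * \<mu> x"
    using m by (intro mult_left_mono) auto
  also have "\<dots> \<le> inner_wt \<mu> (flow G f t) (flow G f t)" by (rule weight_le_inner_self)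
  also have "\<dots> \<le> exp (- 2 * k * t) * inner_wt \<mu> f f" using flow_exp_decay[OF gap mf t] .
  also have "\<dots> \<le> (exp (- k * t))\<^sup>2"
    using f1 mult_left_mono[OF f1, of "exp (- 2 * k * t)"]
    by (simp add: power2_eq_square mult_ac flip: exp_add)
  finally have "(flow G f t x)\<^sup>2 \<le> (exp (- k * t) / sqrt m)\<^sup>2"
    using m by (simp add: field_simps power_divide)
  then have "flow G f t x \<le> exp (- k * t) / sqrt m"
    by (rule power2_le_imp_le) (use m in simp)
  then show ?thesis using eq by (simp add: tv_dist_def)
qed

end

lemma t_mix_le_mult:
  assumes C: "0 < C"
    and imp: "\<And>t. 0 \<le> t \<Longrightarrow> (\<And>x. tv_dist (semigroup_of G t x) \<pi> < e)
        \<Longrightarrow> (\<And>x. tv_dist (semigroup_of H (C * t) x) \<pi> < e)"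
  shows "t_mix H \<pi> e \<le> ennreal C * t_mix G \<pi> e"
proof -
  have sup: "(SUP x. tv_dist (semigroup_of K t x) \<pi>) < e
      \<longleftrightarrow> (\<forall>x. tv_dist (semigroup_of K t x) \<pi> < e)" for K :: "'a::finite \<Rightarrow> 'a \<Rightarrow> real" and t
    by (subst finite_Sup_less_iff) auto
  have "t_mix H \<pi> e / ennreal C \<le> t_mix G \<pi> e"
    unfolding t_mix_def[of G]
  proof (rule Inf_greatest)
    fix a assume "a \<in> {ennreal t | t. 0 \<le> t \<and> (SUP x. tv_dist (semigroup_of G t x) \<pi>) < e}"
    then obtain t where a: "a = ennreal t" "0 \<le> t" "\<And>x. tv_dist (semigroup_of G t x) \<pi> < e"
      by (auto simp: sup)
    then have "t_mix H \<pi> e \<le> ennreal (C * t)"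
      unfolding t_mix_def using imp[of t] C
      by (intro Inf_lower CollectI exI[of _ "C * t"]) (auto simp: sup)
    then show "t_mix H \<pi> e / ennreal C \<le> a"
      using a C by (intro divide_le_posI_ennreal) (auto simp: ennreal_mult)
  qed
  then have "ennreal C * (t_mix H \<pi> e / ennreal C) \<le> ennreal C * t_mix G \<pi> e"
    by (rule mult_left_mono) simp
  moreover have "ennreal C * (t_mix H \<pi> e / ennreal C) = t_mix H \<pi> e"
    using C by (simp add: ennreal_times_divide mult.commute[of "ennreal C"] ennreal_mult_divide_eq)
  ultimately show ?thesis by simp
qed

text \<open>The iteration number \<open>n\<close> and the minimal weight \<open>m\<close> are determined by \<open>\<mu>\<close>, hence so is \<open>C\<close>. With
  the Poincare constant \<open>k = 3/(8 n t)\<close> the product \<open>k C t\<close> is independent of \<open>t\<close>, and it has to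
  exceed \<open>ln (2 / sqrt m)\<close>.\<close>

lemma mixing_constant:
  fixes \<mu> :: "'a::finite \<Rightarrow> real"
  assumes pos: "\<And>x. 0 < \<mu> x"
  shows "\<exists>C>0. \<forall>M1 M2. ordered_generators \<mu> M1 M2 \<longrightarrow>
    t_mix M2 \<mu> (1/4) \<le> ennreal C * t_mix M1 \<mu> (1/4)"
proof -
  define m where "m = Min (range \<mu>)"
  have m: "m \<le> \<mu> x" for x by (simp add: m_def)
  have "m \<in> range \<mu>" unfolding m_def by (rule Min_in) auto
  then have m0: "0 < m" using pos by auto
  obtain n0 :: nat where n0: "4 / m < 4 ^ n0" using real_arch_pow[of 4 "4 / m"] by auto
  define n where "n = Suc n0"
  have n: "4 \<le> m * 4 ^ n" "0 < real n"
    using n0 m0 by (auto simp: n_def field_simps)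
  define C where "C = (8 * n / 3) * (ln (2 / sqrt m) + 1)"
  show ?thesis
  proof (intro exI[of _ "\<bar>C\<bar> + 1"] conjI allI impI)
    fix M1 M2 :: "'a \<Rightarrow> 'a \<Rightarrow> real" assume "ordered_generators \<mu> M1 M2"
    then interpret ordered_generators \<mu> M1 M2 .
    let ?C = "\<bar>C\<bar> + 1"
    show "t_mix M2 \<mu> (1/4) \<le> ennreal ?C * t_mix M1 \<mu> (1/4)"
    proof (rule t_mix_le_mult)
      fix t x assume t: "0 \<le> t" and tv: "\<And>x. tv_dist (semigroup_of M1 t x) \<mu> < 1 / 4"
      show "tv_dist (semigroup_of M2 (?C * t) x) \<mu> < 1 / 4"
      \<comment> \<open>at time 0 both semigroups are the identity, and the constant \<open>k\<close> below would be meaningless\<close>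
      proof (cases "t = 0")
        case True
        then show ?thesis using tv[of x] by (simp add: tv_dist_def semigroup_of_0)
      next
        case False
        define k where "k = 3 / (8 * n * t)"
        have t0: "0 < t" using t False by simp
        have gap: "k * inner_wt \<mu> f f \<le> fast.energy f f" if "mean \<mu> f = 0" for f
        proof -
          have "k * inner_wt \<mu> f f \<le> slow.energy f f"
            using slow.poincare_of_mixing[OF tv t that m n(1)] t0 n(2)
              pos_divide_le_eq[of "2 * (n * t)" "3 / 4 * inner_wt \<mu> f f" "slow.energy f f"]
            by (simp add: k_def mult_ac)
          then show ?thesis using energy_le[of f] by linarith
        qed
        have "ln (2 / sqrt m) < k * (?C * t)"
        proof -
          have "k * (?C * t) = 3 * ?C / (8 * n)" using t0 by (simp add: k_def)
          moreover have "ln (2 / sqrt m) + 1 = 3 * C / (8 * n)"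
            using n(2) by (simp add: C_def)
          moreover have "3 * C / (8 * n) \<le> 3 * ?C / (8 * n)"
            using n(2) by (intro divide_right_mono) auto
          ultimately show ?thesis by linarith
        qed
        then have "exp (- k * (?C * t)) < exp (- ln (2 / sqrt m))" by simp
        also have "\<dots> = sqrt m / 2" using m0 by (simp add: exp_minus)
        finally have "exp (- k * (?C * t)) / sqrt m / 2 < 1 / 4"
          using m0 by (simp add: field_simps)
        moreover have "tv_dist (semigroup_of M2 (?C * t) x) \<mu> \<le> exp (- k * (?C * t)) / sqrt m / 2"
          using fast.tv_le_exp[OF gap _ m m0, of "?C * t" x] t by simp
        ultimately show ?thesis by simp
      qed
    qed simp
  qed simp
qed

section \<open>The chain observed on a time grid\<close>

primrec path_weight :: "('a \<Rightarrow> 'a \<Rightarrow> real) \<Rightarrow> 'a \<Rightarrow> 'a list \<Rightarrow> real" where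
  "path_weight p x [] = 1"
| "path_weight p x (y # ys) = p x y * path_weight p y ys"

lemma fdd_grid:
  "length ys = n \<Longrightarrow>
    fdd G (real k * h) x (zip (map (\<lambda>j. real j * h) [Suc k..<Suc k + n]) ys)
    = path_weight (semigroup_of G h) x ys"
proof (induction ys arbitrary: k n x)
  case (Cons y ys)
  have "[Suc k..<Suc k + n] = Suc k # [Suc (Suc k)..<Suc (Suc k) + length ys]"
    using Cons.prems by (auto simp: upt_conv_Cons)
  moreover have "real (Suc k) * h - real k * h = h" by (simp add: algebra_simps)
  ultimately show ?case using Cons.IH[OF refl, of "Suc k" y]
    by (simp del: of_nat_Suc upt_Suc)
qed simp

lemma map_eq_iff_zip:
  "length ts = length ys \<Longrightarrow> map f ts = ys \<longleftrightarrow> (\<forall>(t, y)\<in>set (zip ts ys). f t = y)"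
  by (induction ts ys rule: list_induct2) auto

text \<open>Splitting off the first letter of a word is the first step decomposition of a path.\<close>

lemma sum_lists_Suc:
  fixes f :: "'a::finite list \<Rightarrow> real"
  shows "(\<Sum>l | length l = Suc n. f l) = (\<Sum>y\<in>UNIV. \<Sum>l | length l = n. f (y # l))"
proof -
  have "(\<Sum>y\<in>UNIV. \<Sum>l | length l = n. f (y # l)) = (\<Sum>(y, l)\<in>UNIV \<times> {l. length l = n}. f (y # l))"
    by (rule sum.cartesian_product)
  also have "\<dots> = (\<Sum>l | length l = Suc n. f l)"
    by (rule sum.reindex_bij_witness[of _ "\<lambda>l. (hd l, tl l)" "\<lambda>(y, l). y # l"])
      (auto simp: length_Suc_conv)
  finally show ?thesis by simp
qed

lemma finite_lists_length: "finite {l :: 'a::finite list. length l = n}"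
  using finite_lists_length_eq[of "UNIV :: 'a set" n] by simp

locale realised_chain =
  fixes G :: "'a::finite \<Rightarrow> 'a \<Rightarrow> real" and P :: "'a \<Rightarrow> 'w measure" and X :: "real \<Rightarrow> 'w \<Rightarrow> 'a"
  assumes ctmc: "ctmc G P X"
begin

lemma prob_space_P: "prob_space (P x)"
  using ctmc by (simp add: ctmc_def)

lemma measurable_X: "0 \<le> t \<Longrightarrow> X t \<in> measurable (P x) (count_space UNIV)"
  using ctmc by (simp add: ctmc_def)

lemma right_continuous:
  assumes "\<omega> \<in> space (P x)" "0 \<le> t"
  obtains d where "0 < d" "\<And>s. t \<le> s \<Longrightarrow> s < t + d \<Longrightarrow> X s \<omega> = X t \<omega>"
proof -
  have "\<forall>x. \<forall>\<omega>\<in>space (P x). \<forall>t\<ge>0. \<exists>\<delta>>0. \<forall>s\<in>{t..<t + \<delta>}. X s \<omega> = X t \<omega>"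
    using ctmc unfolding ctmc_def by (elim conjE)
  then have "\<exists>\<delta>>0. \<forall>s\<in>{t..<t + \<delta>}. X s \<omega> = X t \<omega>"
    using assms by auto
  then obtain d where d: "0 < d \<and> (\<forall>s\<in>{t..<t + d}. X s \<omega> = X t \<omega>)" ..
  show ?thesis
  proof (rule that[of d])
    show "X s \<omega> = X t \<omega>" if "t \<le> s" "s < t + d" for s
      using d that by (meson atLeastLessThan_iff)
  qed (use d in blast)
qed

lemma measure_fdd:
  assumes "sorted (map fst r)" "\<And>t y. (t, y) \<in> set r \<Longrightarrow> 0 \<le> t"
  shows "measure (P x) {\<omega> \<in> space (P x). \<forall>(t, y)\<in>set r. X t \<omega> = y} = fdd G 0 x r"
proof -
  have "\<forall>x r. sorted (map fst r) \<longrightarrow> (\<forall>(t, y)\<in>set r. 0 \<le> t) \<longrightarrow>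
      measure (P x) {\<omega> \<in> space (P x). \<forall>(t, y)\<in>set r. X t \<omega> = y} = fdd G 0 x r"
    using ctmc unfolding ctmc_def by (elim conjE)
  then show ?thesis using assms by auto
qed

definition skeleton :: "real \<Rightarrow> nat \<Rightarrow> 'w \<Rightarrow> 'a list" where
  "skeleton h N \<omega> = map (\<lambda>k. X (real k * h) \<omega>) [0..<Suc N]"

lemma length_skeleton [simp]: "length (skeleton h N \<omega>) = Suc N"
  by (simp add: skeleton_def)

lemma sets_X_eq: "0 \<le> t \<Longrightarrow> {\<omega> \<in> space (P x). X t \<omega> = y} \<in> sets (P x)"
  using measurable_sets[OF measurable_X[of t x], of "{y}"]
  by (simp add: vimage_def Int_def conj_commute)

lemma sets_skeleton_eq:
  assumes "0 \<le> h" shows "{\<omega> \<in> space (P x). skeleton h N \<omega> = l} \<in> sets (P x)"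
proof (cases "length l = Suc N")
  case True
  have "{\<omega> \<in> space (P x). skeleton h N \<omega> = l}
      = {\<omega> \<in> space (P x). \<forall>k\<in>{..N}. X (real k * h) \<omega> = l ! k}"
    using True by (auto simp: skeleton_def list_eq_iff_nth_eq nth_append less_Suc_eq_le simp del: upt_Suc)
  also have "\<dots> \<in> sets (P x)"
    using assms by (intro sets.sets_Collect_finite_All sets_X_eq) auto
  finally show ?thesis .
next
  case False
  then have "{\<omega> \<in> space (P x). skeleton h N \<omega> = l} = {}" by auto
  then show ?thesis by (simp only: sets.empty_sets)
qed

lemma prob_skeleton_eq:
  assumes h: "0 \<le> h" and l: "length ys = N"
  shows "measure (P x) {\<omega> \<in> space (P x). skeleton h N \<omega> = y # ys}
      = (if y = x then path_weight (semigroup_of G h) x ys else 0)"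
proof -
  let ?ts = "map (\<lambda>k. real k * h) [0..<Suc N]"
  have pe: "skeleton h N \<omega> = y # ys \<longleftrightarrow> (\<forall>(t, z)\<in>set (zip ?ts (y # ys)). X t \<omega> = z)" for \<omega>
    using map_eq_iff_zip[of ?ts "y # ys" "\<lambda>t. X t \<omega>"] l by (simp add: skeleton_def comp_def del: upt_Suc)
  have "sorted (map fst (zip ?ts (y # ys)))"
    using l h by (simp add: sorted_iff_nth_mono mult_right_mono nth_append del: upt_Suc)
  moreover have "0 \<le> t" if "(t, z) \<in> set (zip ?ts (y # ys))" for t z
    using set_zip_leftD[OF that] h by auto
  ultimately have "measure (P x) {\<omega> \<in> space (P x). skeleton h N \<omega> = y # ys} = fdd G 0 x (zip ?ts (y # ys))"
    unfolding pe by (rule measure_fdd)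
  also have "zip ?ts (y # ys) = (0, y) # zip (map (\<lambda>k. real k * h) [Suc 0..<Suc 0 + N]) ys"
    by (simp add: upt_conv_Cons del: upt_Suc)
  also have "fdd G 0 x \<dots> = (if y = x then path_weight (semigroup_of G h) x ys else 0)"
    using fdd_grid[OF l, of G 0 h y] by (simp add: semigroup_of_0)
  finally show ?thesis .
qed

lemma skeleton_function_conv:
  "\<omega> \<in> space (P x) \<Longrightarrow> (F (skeleton h N \<omega>) :: real) =
    (\<Sum>l | length l = Suc N. F l * indicator {\<omega> \<in> space (P x). skeleton h N \<omega> = l} \<omega>)"
  by (simp add: indicator_def of_bool_def if_distrib[of "\<lambda>c. _ * c"]
      sum.delta'[OF finite_lists_length] cong: if_cong)

lemma integrable_skeleton:
  assumes h: "0 \<le> h" shows "integrable (P x) (\<lambda>\<omega>. F (skeleton h N \<omega>) :: real)"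
proof -
  interpret prob_space "P x" by (rule prob_space_P)
  show ?thesis
    by (subst Bochner_Integration.integrable_cong[OF refl skeleton_function_conv])
      (auto intro!: integrable_sum integrable_mult_right integrable_real_indicator sets_skeleton_eq[OF h]
        simp: less_top[symmetric])
qed

lemma expectation_skeleton:
  assumes h: "0 \<le> h"
  shows "(\<integral>\<omega>. F (skeleton h N \<omega>) \<partial>P x)
    = (\<Sum>ys | length ys = N. path_weight (semigroup_of G h) x ys * F (x # ys))"
proof -
  interpret prob_space "P x" by (rule prob_space_P)
  let ?E = "\<lambda>l. {\<omega> \<in> space (P x). skeleton h N \<omega> = l}"
  have "(\<integral>\<omega>. F (skeleton h N \<omega>) \<partial>P x) = (\<integral>\<omega>. (\<Sum>l | length l = Suc N. F l * indicator (?E l) \<omega>) \<partial>P x)"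
    by (rule Bochner_Integration.integral_cong[OF refl skeleton_function_conv])
  also have "\<dots> = (\<Sum>l | length l = Suc N. F l * measure (P x) (?E l))"
    using sets_skeleton_eq[OF h]
    by (subst Bochner_Integration.integral_sum)
      (auto intro!: integrable_mult_right integrable_real_indicator sum.cong simp: less_top[symmetric])
  also have "\<dots> = (\<Sum>y\<in>UNIV. \<Sum>ys | length ys = N. F (y # ys) * measure (P x) (?E (y # ys)))"
    by (rule sum_lists_Suc)
  also have "\<dots> = (\<Sum>y\<in>UNIV. if y = x then
      (\<Sum>ys | length ys = N. path_weight (semigroup_of G h) x ys * F (x # ys)) else 0)"
    by (intro sum.cong refl) (auto simp: prob_skeleton_eq[OF h] mult.commute)
  also have "\<dots> = (\<Sum>ys | length ys = N. path_weight (semigroup_of G h) x ys * F (x # ys))" by simp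
  finally show ?thesis .
qed

text \<open>The Markov property of the chain on the grid at its first step.\<close>

lemma expectation_skeleton_Suc:
  assumes h: "0 \<le> h"
  shows "(\<integral>\<omega>. F (skeleton h (Suc N) \<omega>) \<partial>P x)
    = (\<Sum>y\<in>UNIV. semigroup_of G h x y * (\<integral>\<omega>. F (x # skeleton h N \<omega>) \<partial>P y))"
  unfolding expectation_skeleton[OF h] expectation_skeleton[OF h, where F = "\<lambda>l. F (x # l)"] sum_lists_Suc
  by (simp add: sum_distrib_left mult_ac)

lemma AE_start: "AE \<omega> in P x. X 0 \<omega> = x"
proof -
  interpret prob_space "P x" by (rule prob_space_P)
  have "prob {\<omega> \<in> space (P x). X 0 \<omega> = x} = 1"
    using measure_fdd[of "[(0, x)]" x] by (simp add: semigroup_of_0)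
  then show ?thesis using AE_in_set_eq_1[OF sets_X_eq[of 0 x x]] by auto
qed

lemma expectation_of_limit:
  fixes f :: "nat \<Rightarrow> 'w \<Rightarrow> real"
  assumes lim: "\<And>\<omega>. \<omega> \<in> space (P x) \<Longrightarrow> (\<lambda>n. f n \<omega>) \<longlonglongrightarrow> g \<omega>"
    and meas: "\<And>n. f n \<in> borel_measurable (P x)"
    and bound: "\<And>n \<omega>. \<bar>f n \<omega>\<bar> \<le> 1"
  shows "g \<in> borel_measurable (P x)" "(\<lambda>n. \<integral>\<omega>. f n \<omega> \<partial>P x) \<longlonglongrightarrow> (\<integral>\<omega>. g \<omega> \<partial>P x)"
proof -
  interpret prob_space "P x" by (rule prob_space_P)
  show g: "g \<in> borel_measurable (P x)"
    by (rule borel_measurable_LIMSEQ_real[OF lim meas])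
  show "(\<lambda>n. \<integral>\<omega>. f n \<omega> \<partial>P x) \<longlonglongrightarrow> (\<integral>\<omega>. g \<omega> \<partial>P x)"
    using lim bound by (intro integral_dominated_convergence[where w = "\<lambda>_. 1"] g meas) auto
qed

end

text \<open>The value is a time rather than an index, so that it can be compared with the hitting time in continuous time.\<close>

definition first_time :: "real \<Rightarrow> (nat \<Rightarrow> bool) \<Rightarrow> ennreal" where
  "first_time h p = Inf {ennreal (real k * h) | k. p k}"

lemma first_time_none: "(\<And>k. \<not> p k) \<Longrightarrow> first_time h p = \<infinity>"
  by (simp add: first_time_def)

lemma first_time_le: "p k \<Longrightarrow> first_time h p \<le> ennreal (real k * h)"
  unfolding first_time_def by (intro Inf_lower) auto

lemma first_time_eq:
  assumes h: "0 \<le> h" and k: "p k" "\<And>i. i < k \<Longrightarrow> \<not> p i"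
  shows "first_time h p = ennreal (real k * h)"
proof (rule antisym)
  show "ennreal (real k * h) \<le> first_time h p"
    unfolding first_time_def
  proof (intro Inf_greatest, clarify)
    fix i assume "p i"
    then have "k \<le> i" using k(2) not_le by blast
    then show "ennreal (real k * h) \<le> ennreal (real i * h)"
      using h by (intro ennreal_leI mult_right_mono) auto
  qed
qed (rule first_time_le[of p, OF k(1)])

lemma first_time_less_iff:
  assumes h: "0 < h"
  shows "first_time h p < first_time h r \<longleftrightarrow> (\<exists>k. p k \<and> (\<forall>i\<le>k. \<not> r i))"
proof
  assume less: "first_time h p < first_time h r"
  have "\<exists>k. p k"
  proof (rule ccontr)
    assume "\<nexists>k. p k"
    then have "first_time h p = \<infinity>" by (intro first_time_none) auto
    then show False using less by simp
  qed
  then obtain k where k: "p k" "\<And>i. i < k \<Longrightarrow> \<not> p i" using exists_least_iff[of p] by blast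
  have "\<not> r i" if "i \<le> k" for i
  proof
    assume "r i"
    then have "first_time h r \<le> ennreal (real i * h)" by (rule first_time_le)
    also have "\<dots> \<le> ennreal (real k * h)" using that h by (intro ennreal_leI mult_right_mono) auto
    also have "\<dots> = first_time h p" using first_time_eq[of h p k] k h by simp
    finally show False using less by simp
  qed
  then show "\<exists>k. p k \<and> (\<forall>i\<le>k. \<not> r i)" using k by blast
next
  assume "\<exists>k. p k \<and> (\<forall>i\<le>k. \<not> r i)"
  then obtain k where k: "p k" "\<And>i. i \<le> k \<Longrightarrow> \<not> r i" by blast
  have "first_time h p \<le> ennreal (real k * h)" using k by (intro first_time_le)
  also have "\<dots> < ennreal (real (Suc k) * h)" using h by (intro ennreal_lessI) auto
  also have "\<dots> \<le> first_time h r"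
    unfolding first_time_def
  proof (intro Inf_greatest, clarify)
    fix i assume "r i"
    then have "Suc k \<le> i" using k(2) not_less_eq_eq by blast
    then show "ennreal (real (Suc k) * h) \<le> ennreal (real i * h)"
      using h by (intro ennreal_leI mult_right_mono) (simp_all del: of_nat_Suc)
  qed
  finally show "first_time h p < first_time h r" .
qed

text \<open>The discounted indicator \<open>q\<^sup>k\<close> of a first visit to \<open>A \<union> B\<close> that takes place in \<open>B\<close>, at step \<open>k\<close>.\<close>

fun first_hit :: "real \<Rightarrow> 'a set \<Rightarrow> 'a set \<Rightarrow> 'a list \<Rightarrow> real" where
  "first_hit q A B [] = 0"
| "first_hit q A B (y # ys) = (if y \<in> B then 1 else if y \<in> A then 0 else q * first_hit q A B ys)"

text \<open>The indicator that \<open>B\<close> is visited before \<open>A\<close> once the skeleton has left \<open>x\<close>. The state entered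
  at the departure counts as a visit.\<close>

fun first_return :: "'a \<Rightarrow> 'a set \<Rightarrow> 'a set \<Rightarrow> 'a list \<Rightarrow> real" where
  "first_return x A B [] = 0"
| "first_return x A B (y # ys) = (if y = x then first_return x A B ys else first_hit 1 A B (y # ys))"

lemma first_hit_bound: "0 \<le> q \<Longrightarrow> q \<le> 1 \<Longrightarrow> 0 \<le> first_hit q A B l \<and> first_hit q A B l \<le> 1"
  by (induction l) (auto simp: mult_le_one)

lemma first_return_bound: "0 \<le> first_return x A B l \<and> first_return x A B l \<le> 1"
  by (induction l) (use first_hit_bound[of 1 A B] in auto)

lemma map_upt_shift: "map s [0..<Suc N] = s 0 # map (\<lambda>k. s (Suc k)) [0..<N]"
  by (simp add: upt_conv_Cons map_Suc_upt[symmetric] comp_def del: upt_Suc)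

lemma first_hit_eq_power:
  assumes "s k \<in> B" "\<And>i. i < k \<Longrightarrow> s i \<notin> A \<and> s i \<notin> B" "k < N"
  shows "first_hit q A B (map s [0..<N]) = q ^ k"
  using assms
proof (induction N arbitrary: s k)
  case (Suc N)
  show ?case
  proof (cases k)
    case 0
    then show ?thesis using Suc.prems(1) by (simp add: map_upt_shift del: upt_Suc)
  next
    case (Suc j)
    then have "first_hit q A B (map (\<lambda>k. s (Suc k)) [0..<N]) = q ^ j"
      using Suc.prems by (intro Suc.IH) auto
    then show ?thesis using Suc Suc.prems(2)[of 0] by (simp add: map_upt_shift del: upt_Suc)
  qed
qed simp

lemma first_hit_eq_0:
  assumes "\<And>k. s k \<in> B \<Longrightarrow> \<exists>i\<le>k. s i \<in> A" and disj: "A \<inter> B = {}"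
  shows "first_hit q A B (map s [0..<N]) = 0"
  using assms(1)
proof (induction N arbitrary: s)
  case (Suc N)
  have s0: "s 0 \<notin> B" using Suc.prems[of 0] disj by auto
  show ?case
  proof (cases "s 0 \<in> A")
    case False
    have "first_hit q A B (map (\<lambda>k. s (Suc k)) [0..<N]) = 0"
    proof (rule Suc.IH)
      fix k assume "s (Suc k) \<in> B"
      then obtain i where "i \<le> Suc k" "s i \<in> A" using Suc.prems by blast
      then show "\<exists>i\<le>k. s (Suc i) \<in> A" using False by (cases i) auto
    qed
    then show ?thesis using s0 by (simp add: map_upt_shift del: upt_Suc)
  qed (use s0 in \<open>simp add: map_upt_shift del: upt_Suc\<close>)
qed simp

lemma first_hit_one_eq_1:
  assumes "s k \<in> B" "\<And>i. i \<le> k \<Longrightarrow> s i \<notin> A" "k < N"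
  shows "first_hit 1 A B (map s [0..<N]) = 1"
proof -
  obtain j where j: "s j \<in> B" "\<And>i. i < j \<Longrightarrow> s i \<notin> B"
    using exists_least_iff[of "\<lambda>k. s k \<in> B"] assms(1) by blast
  then have "j \<le> k" using assms(1) not_le by blast
  then have "first_hit 1 A B (map s [0..<N]) = 1 ^ j"
    using j assms by (intro first_hit_eq_power) auto
  then show ?thesis by simp
qed

lemma first_return_eq_1:
  assumes "s k \<in> B" "\<exists>j\<le>k. s j \<noteq> x" "\<And>i. i \<le> k \<Longrightarrow> s i \<in> A \<Longrightarrow> \<forall>j\<le>i. s j = x" "k < N"
  shows "first_return x A B (map s [0..<N]) = 1"
  using assms
proof (induction N arbitrary: s k)
  case (Suc N)
  show ?case
  proof (cases "s 0 = x")
    case True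
    obtain j where j: "j \<le> k" "s j \<noteq> x" using Suc.prems by blast
    then obtain j' k' where jk: "j = Suc j'" "k = Suc k'" using True by (cases j; cases k) auto
    have "first_return x A B (map (\<lambda>k. s (Suc k)) [0..<N]) = 1"
    proof (rule Suc.IH[of _ k'])
      show "\<forall>j\<le>i. s (Suc j) = x" if "i \<le> k'" "s (Suc i) \<in> A" for i
        using Suc.prems(3)[of "Suc i"] that jk by auto
    qed (use Suc.prems j jk in auto)
    then show ?thesis using True by (simp add: map_upt_shift del: upt_Suc)
  next
    case False
    have "first_hit 1 A B (map s [0..<Suc N]) = 1"
      using Suc.prems False by (intro first_hit_one_eq_1[of _ k]) auto
    then show ?thesis using False by (simp add: map_upt_shift del: upt_Suc)
  qed
qed simp

lemma first_return_eq_0: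
  assumes "\<And>k. s k \<in> B \<Longrightarrow> \<exists>j\<le>k. s j \<noteq> x \<Longrightarrow> \<exists>i\<le>k. s i \<in> A \<and> (\<exists>j\<le>i. s j \<noteq> x)"
    and disj: "A \<inter> B = {}"
  shows "first_return x A B (map s [0..<N]) = 0"
  using assms(1)
proof (induction N arbitrary: s)
  case (Suc N)
  show ?case
  proof (cases "s 0 = x")
    case True
    have "first_return x A B (map (\<lambda>k. s (Suc k)) [0..<N]) = 0"
    proof (rule Suc.IH)
      fix k assume "s (Suc k) \<in> B" "\<exists>j\<le>k. s (Suc j) \<noteq> x"
      then obtain i j where ij: "i \<le> Suc k" "s i \<in> A" "j \<le> i" "s j \<noteq> x"
        using Suc.prems[of "Suc k"] by (meson Suc_le_mono)
      then obtain j' i' where "j = Suc j'" "i = Suc i'" using True by (cases j; cases i) auto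
      then show "\<exists>i\<le>k. s (Suc i) \<in> A \<and> (\<exists>j\<le>i. s (Suc j) \<noteq> x)" using ij by auto
    qed
    then show ?thesis using True by (simp add: map_upt_shift del: upt_Suc)
  next
    case False
    have "first_hit 1 A B (map s [0..<Suc N]) = 0"
    proof (rule first_hit_eq_0[OF _ disj])
      show "\<exists>i\<le>k. s i \<in> A" if "s k \<in> B" for k using Suc.prems[OF that] False by blast
    qed
    then show ?thesis using False by (simp add: map_upt_shift del: upt_Suc)
  qed
qed simp

definition discount_before :: "real \<Rightarrow> ennreal \<Rightarrow> ennreal \<Rightarrow> real" where
  "discount_before l T S = (if T < S then exp (- (l * enn2real T)) else 0)"

text \<open>Both sides are decided by the first visit to \<open>B\<close>; a finite part of the path determines the value.\<close>

lemma first_hit_tendsto: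
  assumes h: "0 < h" and disj: "A \<inter> B = {}"
  shows "(\<lambda>N. first_hit (exp (- (l * h))) A B (map s [0..<Suc N]))
    \<longlonglongrightarrow> discount_before l (first_time h (\<lambda>k. s k \<in> B)) (first_time h (\<lambda>k. s k \<in> A))"
proof (cases "\<exists>k. s k \<in> B \<and> (\<forall>i\<le>k. s i \<notin> A)")
  case True
  then obtain k' where k': "s k' \<in> B" "\<forall>i\<le>k'. s i \<notin> A" by blast
  then obtain k where k: "s k \<in> B" "\<And>i. i < k \<Longrightarrow> s i \<notin> B"
    using exists_least_iff[of "\<lambda>k. s k \<in> B"] by blast
  then have kk: "k \<le> k'" using k'(1) not_le by blast
  have v: "first_hit (exp (- (l * h))) A B (map s [0..<N]) = exp (- (l * h)) ^ k" if "k < N" for N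
    using k k' kk that by (intro first_hit_eq_power) auto
  have "first_time h (\<lambda>k. s k \<in> B) = ennreal (real k * h)"
    using first_time_eq[of h "\<lambda>k. s k \<in> B" k] k h by auto
  moreover have "first_time h (\<lambda>k. s k \<in> B) < first_time h (\<lambda>k. s k \<in> A)"
    using True h by (simp add: first_time_less_iff)
  ultimately have "discount_before l (first_time h (\<lambda>k. s k \<in> B)) (first_time h (\<lambda>k. s k \<in> A))
      = exp (- (l * h)) ^ k"
    using h by (simp add: discount_before_def mult_ac flip: exp_of_nat_mult)
  moreover have "\<forall>\<^sub>F N in sequentially.
      first_hit (exp (- (l * h))) A B (map s [0..<Suc N]) = exp (- (l * h)) ^ k"
    using eventually_ge_at_top[of k] by eventually_elim (rule v, simp)
  ultimately show ?thesis by (simp only: tendsto_eventually)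
next
  case False
  then have "first_hit (exp (- (l * h))) A B (map s [0..<N]) = 0" for N
    by (intro first_hit_eq_0[OF _ disj]) auto
  moreover have "\<not> first_time h (\<lambda>k. s k \<in> B) < first_time h (\<lambda>k. s k \<in> A)"
    using False h by (simp add: first_time_less_iff)
  ultimately show ?thesis by (simp add: discount_before_def del: upt_Suc)
qed

lemma first_return_tendsto:
  assumes h: "0 < h" and disj: "A \<inter> B = {}"
  shows "(\<lambda>N. first_return x A B (map s [0..<Suc N]))
    \<longlonglongrightarrow> discount_before 0 (first_time h (\<lambda>k. s k \<in> B \<and> (\<exists>j\<le>k. s j \<noteq> x)))
        (first_time h (\<lambda>k. s k \<in> A \<and> (\<exists>j\<le>k. s j \<noteq> x)))"
proof (cases "\<exists>k. (s k \<in> B \<and> (\<exists>j\<le>k. s j \<noteq> x)) \<and> (\<forall>i\<le>k. \<not> (s i \<in> A \<and> (\<exists>j\<le>i. s j \<noteq> x)))")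
  case True
  then obtain k where k: "s k \<in> B" "\<exists>j\<le>k. s j \<noteq> x"
      "\<And>i. i \<le> k \<Longrightarrow> s i \<in> A \<Longrightarrow> \<forall>j\<le>i. s j = x" by blast
  have "\<forall>\<^sub>F N in sequentially. first_return x A B (map s [0..<Suc N]) = 1"
    using eventually_ge_at_top[of k]
    by eventually_elim (rule first_return_eq_1[OF k], auto)
  then show ?thesis using True h
    by (simp only: discount_before_def first_time_less_iff) (simp add: tendsto_eventually del: upt_Suc)
next
  case False
  then have "first_return x A B (map s [0..<N]) = 0" for N
    by (intro first_return_eq_0[OF _ disj]) blast
  then show ?thesis using False h
    by (simp only: discount_before_def first_time_less_iff) (simp del: upt_Suc)
qed

section \<open>From the grid to continuous time\<close>

text \<open>A grid of width below \<open>d\<close> has a point in \<open>[t, t + d)\<close>, so grid times come arbitrarily close to \<open>T\<close> from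
  above. The hypothesis \<open>approx\<close> is what right-continuity of the paths provides: a property that holds
  at time \<open>t\<close> persists for a while.\<close>

lemma grid_first_time_tendsto:
  assumes h: "\<And>n. 0 < h n" "h \<longlonglongrightarrow> 0"
    and T: "T = Inf {ennreal t | t. \<Phi> t}" and nonneg: "\<And>t. \<Phi> t \<Longrightarrow> 0 \<le> t"
    and lower: "\<And>n k. p n k \<Longrightarrow> T \<le> ennreal (real k * h n)"
    and approx: "\<And>t. \<Phi> t \<Longrightarrow> \<exists>d>0. \<forall>\<^sub>F n in sequentially.
        \<forall>k. t \<le> real k * h n \<longrightarrow> real k * h n < t + d \<longrightarrow> p n k"
  shows "T \<le> first_time (h n) (p n)" "(\<lambda>n. first_time (h n) (p n)) \<longlonglongrightarrow> T"
proof -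
  show le: "T \<le> first_time (h n) (p n)" for n
    unfolding first_time_def by (intro Inf_greatest) (use lower in auto)
  show "(\<lambda>n. first_time (h n) (p n)) \<longlonglongrightarrow> T"
  proof (rule order_tendstoI)
    fix a assume "a < T"
    then show "\<forall>\<^sub>F n in sequentially. a < first_time (h n) (p n)"
      using le by (intro always_eventually allI) (rule less_le_trans)
  next
    fix a assume "T < a"
    then obtain t where t: "\<Phi> t" "ennreal t < a" unfolding T Inf_less_iff by blast
    obtain d where d: "0 < d" and ev: "\<forall>\<^sub>F n in sequentially.
        \<forall>k. t \<le> real k * h n \<longrightarrow> real k * h n < t + d \<longrightarrow> p n k"
      using approx[OF t(1)] by blast
    obtain e where e: "0 < e" "ennreal (t + e) \<le> a"
    proof (cases a)
      case (real r)
      then show ?thesis using t nonneg[OF t(1)] that[of "r - t"]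
        by (simp add: ennreal_less_iff)
    next
      case top
      then show ?thesis using that[of 1] by simp
    qed
    have "\<forall>\<^sub>F n in sequentially. h n < min d e"
      using h(2) d e by (intro order_tendstoD(2)) auto
    then show "\<forall>\<^sub>F n in sequentially. first_time (h n) (p n) < a"
      using ev
    proof eventually_elim
      case (elim n)
      define k where "k = nat \<lceil>t / h n\<rceil>"
      have "0 \<le> t / h n" using nonneg[OF t(1)] h(1)[of n] by simp
      then have "t / h n \<le> real k" "real k < t / h n + 1" unfolding k_def by linarith+
      then have k: "t \<le> real k * h n" "real k * h n < t + h n"
        using h(1)[of n] by (auto simp: field_simps)
      then have "p n k" using elim by auto
      then have "first_time (h n) (p n) \<le> ennreal (real k * h n)" by (rule first_time_le)
      also have "\<dots> < ennreal (t + e)"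
        using k elim nonneg[OF t(1)] e by (intro ennreal_lessI) auto
      finally show ?case using e(2) by simp
    qed
  qed
qed

text \<open>The value jumps where \<open>T = S\<close> and, for \<open>l = 0\<close>, where \<open>T = \<infinity>\<close>. The first is excluded for finite times by
  assumption. The second is harmless because the approximation is from above.\<close>

lemma discount_before_tendsto:
  assumes lim: "T' \<longlonglongrightarrow> T" "S' \<longlonglongrightarrow> S" and le: "\<And>n. T \<le> T' n" "\<And>n. S \<le> S' n"
    and ne: "T = S \<Longrightarrow> T = \<infinity>"
  shows "(\<lambda>n. discount_before l (T' n) (S' n)) \<longlonglongrightarrow> discount_before l T S"
proof -
  consider "T < S" | "S < T" | "T = \<infinity>" "S = \<infinity>" using ne by (cases T S rule: linorder_cases) auto
  then show ?thesis
  proof cases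
    case 1
    then have fin: "T \<noteq> \<infinity>" by auto
    have "\<forall>\<^sub>F n in sequentially. T' n < S" using lim(1) 1 by (rule order_tendstoD(2))
    then have "\<forall>\<^sub>F n in sequentially. exp (- (l * enn2real (T' n))) = discount_before l (T' n) (S' n)"
      by eventually_elim (use le(2) in \<open>auto simp: discount_before_def dest: less_le_trans\<close>)
    moreover have "(\<lambda>n. exp (- (l * enn2real (T' n)))) \<longlonglongrightarrow> exp (- (l * enn2real T))"
      using lim(1) fin by (intro tendsto_intros tendsto_enn2real) (auto simp: less_top)
    ultimately show ?thesis
      using 1 by (simp add: discount_before_def tendsto_cong)
  next
    case 2
    have "\<forall>\<^sub>F n in sequentially. S' n < T" using lim(2) 2 by (rule order_tendstoD(2))
    then have "\<forall>\<^sub>F n in sequentially. discount_before l (T' n) (S' n) = 0"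
    proof eventually_elim
      case (elim n)
      then have "\<not> T' n < S' n" using le(1)[of n] by (meson less_le_trans not_less_iff_gr_or_eq)
      then show ?case by (simp add: discount_before_def)
    qed
    then show ?thesis using 2 by (simp add: discount_before_def tendsto_eventually)
  next
    case 3
    then have "T' n = \<infinity>" for n using le(1)[of n] by (simp add: top_unique)
    then show ?thesis using 3 by (simp add: discount_before_def)
  qed
qed

text \<open>The difference quotient of \<open>e\<^sup>-\<^sup>l\<^sup>t P\<^sub>t\<close> at 0 annihilates \<open>z n\<close> at \<open>x\<close>, and it converges to
  \<open>G - l\<close>.\<close>

lemma generator_limit:
  assumes h: "\<And>n. 0 < h n" "h \<longlonglongrightarrow> 0"
    and z: "\<And>y. (\<lambda>n. z n y) \<longlonglongrightarrow> u y"
    and eq: "\<And>n. z n x = exp (- (l * h n)) * (\<Sum>y\<in>UNIV. semigroup_of G (h n) x y * z n y)"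
  shows "l * u x = gen_app G u x"
proof -
  define a where "a t y = exp (- (l * t)) * semigroup_of G t x y" for t y
  define c where "c y = G x y - l * (if x = y then 1 else 0)" for y
  have "((\<lambda>t. a t y) has_real_derivative c y) (at 0)" for y
  proof -
    have "((\<lambda>t. exp (- (l * t)) * semigroup_of G t x y) has_real_derivative
        (- l) * semigroup_of G 0 x y + (\<Sum>z\<in>UNIV. G x z * semigroup_of G 0 z y)) (at 0)"
      by (auto intro!: derivative_eq_intros semigroup_of_DERIV)
    then show ?thesis
      by (cases "x = y") (simp_all add: a_def c_def semigroup_of_0 if_distrib[of "\<lambda>c. _ * c"] cong: if_cong)
  qed
  then have "((\<lambda>t. (a t y - a 0 y) / t) \<longlongrightarrow> c y) (at 0)" for y
    by (simp add: has_field_derivative_iff)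
  moreover have "filterlim h (at 0) sequentially"
    using h by (auto simp: filterlim_at intro!: always_eventually less_imp_neq[symmetric])
  ultimately have "(\<lambda>n. (a (h n) y - a 0 y) / h n) \<longlonglongrightarrow> c y" for y
    using filterlim_compose by blast
  then have "(\<lambda>n. \<Sum>y\<in>UNIV. (a (h n) y - a 0 y) / h n * z n y) \<longlonglongrightarrow> (\<Sum>y\<in>UNIV. c y * u y)"
    by (intro tendsto_sum tendsto_mult z)
  moreover have "(\<Sum>y\<in>UNIV. (a (h n) y - a 0 y) / h n * z n y) = 0" for n
  proof -
    have "(\<Sum>y\<in>UNIV. (a (h n) y - a 0 y) / h n * z n y)
        = ((\<Sum>y\<in>UNIV. a (h n) y * z n y) - (\<Sum>y\<in>UNIV. a 0 y * z n y)) / h n"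
      by (simp add: left_diff_distrib diff_divide_distrib sum_subtractf sum_divide_distrib)
    also have "(\<Sum>y\<in>UNIV. a 0 y * z n y) = z n x"
      by (simp add: a_def semigroup_of_0 if_distrib[of "\<lambda>c. c * _"] cong: if_cong)
    also have "(\<Sum>y\<in>UNIV. a (h n) y * z n y) = z n x"
      by (subst eq) (simp add: a_def sum_distrib_left mult.assoc)
    finally show ?thesis by simp
  qed
  ultimately have "(\<Sum>y\<in>UNIV. c y * u y) = 0" by (simp add: LIMSEQ_const_iff)
  then show ?thesis
    by (simp add: c_def gen_app_def left_diff_distrib sum_subtractf if_distrib[of "\<lambda>c. _ * c"]
        if_distrib[of "\<lambda>c. c * _"] cong: if_cong)
qed

definition mesh :: "nat \<Rightarrow> real" where "mesh n = 1 / real (Suc n)"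

lemma mesh: "0 < mesh n" "mesh \<longlonglongrightarrow> 0"
proof -
  show "mesh \<longlonglongrightarrow> 0" unfolding mesh_def[abs_def] using LIMSEQ_inverse_real_of_nat
    by (simp add: inverse_eq_divide)
qed (simp add: mesh_def)

context realised_chain
begin

text \<open>Times satisfying \<open>\<Phi>\<close> accumulate at \<open>T\<close> from the right or attain it, and the path is constant on some
  interval \<open>[T, T + d)\<close>. Hence disjoint sets are never reached at the same finite time.\<close>

lemma position_at_infimum:
  assumes w: "\<omega> \<in> space (P x)" and T: "T = Inf {ennreal t | t. \<Phi> t}" "T \<noteq> \<infinity>"
    and \<Phi>: "\<And>t. \<Phi> t \<Longrightarrow> 0 \<le> t \<and> X t \<omega> \<in> S"
  shows "X (enn2real T) \<omega> \<in> S"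
proof -
  have Tr: "T = ennreal (enn2real T)" using T(2) by (simp add: less_top)
  obtain d where d: "0 < d" "\<And>s. enn2real T \<le> s \<Longrightarrow> s < enn2real T + d \<Longrightarrow> X s \<omega> = X (enn2real T) \<omega>"
    using right_continuous[OF w, of "enn2real T"] by (metis enn2real_nonneg)
  have "T < ennreal (enn2real T + d)"
    by (subst Tr) (use d in \<open>simp add: ennreal_less_iff\<close>)
  then obtain t where t: "\<Phi> t" "ennreal t < ennreal (enn2real T + d)"
    unfolding T(1) Inf_less_iff by blast
  have "T \<le> ennreal t" unfolding T(1) by (rule Inf_lower) (use t in blast)
  then have "enn2real T \<le> t" using \<Phi>[OF t(1)] enn2real_leI by blast
  moreover have "t < enn2real T + d" using t(2) \<Phi>[OF t(1)] by (simp add: ennreal_less_iff)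
  ultimately show ?thesis using d(2)[of t] \<Phi>[OF t(1)] by simp
qed

lemma hit_eq_infinite:
  assumes "\<omega> \<in> space (P x)" "A \<inter> B = {}" "hit X B \<omega> = hit X A \<omega>"
  shows "hit X B \<omega> = \<infinity>"
proof (rule ccontr)
  assume n: "hit X B \<omega> \<noteq> \<infinity>"
  have "X (enn2real (hit X S \<omega>)) \<omega> \<in> S" if "hit X S \<omega> \<noteq> \<infinity>" for S
    by (rule position_at_infimum[OF assms(1) hit_def that]) blast
  from this[of A] this[of B] n show False using assms(2,3) by auto
qed

lemma ret_eq_infinite:
  assumes "\<omega> \<in> space (P x)" "A \<inter> B = {}" "ret X B \<omega> = ret X A \<omega>"
  shows "ret X B \<omega> = \<infinity>"
proof (rule ccontr)
  assume n: "ret X B \<omega> \<noteq> \<infinity>"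
  have "X (enn2real (ret X S \<omega>)) \<omega> \<in> S" if "ret X S \<omega> \<noteq> \<infinity>" for S
    by (rule position_at_infimum[OF assms(1) ret_def that]) (meson less_imp_le)
  from this[of A] this[of B] n show False using assms(2,3) by auto
qed

lemma hit_grid:
  assumes w: "\<omega> \<in> space (P x)" and h: "\<And>n. 0 < h n" "h \<longlonglongrightarrow> 0"
  shows "hit X S \<omega> \<le> first_time (h n) (\<lambda>k. X (real k * h n) \<omega> \<in> S)"
    and "(\<lambda>n. first_time (h n) (\<lambda>k. X (real k * h n) \<omega> \<in> S)) \<longlonglongrightarrow> hit X S \<omega>"
proof -
  have low: "hit X S \<omega> \<le> ennreal (real k * h n)" if "X (real k * h n) \<omega> \<in> S" for n k
    unfolding hit_def using h(1)[of n] that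
    by (intro Inf_lower CollectI exI[of _ "real k * h n"]) (auto simp: less_imp_le)
  have app: "\<exists>d>0. \<forall>\<^sub>F n in sequentially. \<forall>k. t \<le> real k * h n \<longrightarrow> real k * h n < t + d
      \<longrightarrow> X (real k * h n) \<omega> \<in> S" if "0 \<le> t \<and> X t \<omega> \<in> S" for t
  proof -
    obtain d where d: "0 < d" "\<And>s. t \<le> s \<Longrightarrow> s < t + d \<Longrightarrow> X s \<omega> = X t \<omega>"
      using right_continuous[OF w, of t] \<open>0 \<le> t \<and> X t \<omega> \<in> S\<close> by metis
    have "X (real k * h n) \<omega> \<in> S" if "t \<le> real k * h n" "real k * h n < t + d" for n k
      using d(2)[OF that] \<open>0 \<le> t \<and> X t \<omega> \<in> S\<close> by simp
    then show ?thesis using d(1) by (intro exI[of _ d] conjI always_eventually allI impI)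
  qed
  note * = grid_first_time_tendsto[where p = "\<lambda>n k. X (real k * h n) \<omega> \<in> S", OF h hit_def _ low app]
  show "hit X S \<omega> \<le> first_time (h n) (\<lambda>k. X (real k * h n) \<omega> \<in> S)" using *(1) by blast
  show "(\<lambda>n. first_time (h n) (\<lambda>k. X (real k * h n) \<omega> \<in> S)) \<longlonglongrightarrow> hit X S \<omega>" using *(2) by blast
qed

text \<open>On the grid the departure from \<open>X 0\<close> is allowed at the index of the visit itself, while in
  continuous time it has to come strictly earlier. The infimum does not see the difference: a
  visit in \<open>S\<close> lasts for some time, so it still goes on slightly later.\<close>

lemma ret_grid:
  fixes h :: "nat \<Rightarrow> real" and S :: "'a set"
  assumes w: "\<omega> \<in> space (P x)" and h: "\<And>n. 0 < h n" "h \<longlonglongrightarrow> 0"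
  defines "p \<equiv> \<lambda>n k. X (real k * h n) \<omega> \<in> S \<and> (\<exists>j\<le>k. X (real j * h n) \<omega> \<noteq> X 0 \<omega>)"
  shows "ret X S \<omega> \<le> first_time (h n) (p n)"
    and "(\<lambda>n. first_time (h n) (p n)) \<longlonglongrightarrow> ret X S \<omega>"
proof -
  have low: "ret X S \<omega> \<le> ennreal (real k * h n)" if pk: "p n k" for n k
  proof -
    let ?t = "real k * h n"
    obtain j where j: "j \<le> k" "X (real j * h n) \<omega> \<noteq> X 0 \<omega>" using pk unfolding p_def by blast
    have t0: "0 \<le> ?t" using h(1)[of n] by simp
    obtain d where d: "0 < d" "\<And>s. ?t \<le> s \<Longrightarrow> s < ?t + d \<Longrightarrow> X s \<omega> = X ?t \<omega>"
      by (rule right_continuous[OF w t0]) (rule that)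
    have "j \<noteq> 0" using j by (cases j) auto
    then have jpos: "0 < real j * h n" using h(1)[of n] by simp
    have jk: "real j * h n \<le> ?t" using j(1) h(1)[of n] by (intro mult_right_mono) auto
    show ?thesis
    proof (rule ennreal_le_epsilon)
      fix e :: real assume e: "0 < e"
      define t' where "t' = ?t + min (d / 2) e"
      have t': "?t < t'" "t' < ?t + d" "t' \<le> ?t + e" using d(1) e by (auto simp: t'_def)
      have "X t' \<omega> \<in> S" using d(2)[of t'] t' pk unfolding p_def by simp
      then have "ret X S \<omega> \<le> ennreal t'"
        unfolding ret_def using jpos jk t' j(2)
        by (intro Inf_lower CollectI exI[of _ t'] conjI refl exI[of _ "real j * h n"]) auto
      also have "\<dots> \<le> ennreal ?t + ennreal e"
        using t' t0 e by (simp add: ennreal_leI flip: ennreal_plus)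
      finally show "ret X S \<omega> \<le> ennreal ?t + ennreal e" .
    qed
  qed
  have app: "\<exists>d>0. \<forall>\<^sub>F n in sequentially. \<forall>k. t \<le> real k * h n \<longrightarrow> real k * h n < t + d \<longrightarrow> p n k"
    if t: "0 < t \<and> X t \<omega> \<in> S \<and> (\<exists>s. 0 < s \<and> s < t \<and> X s \<omega> \<noteq> X 0 \<omega>)" for t
  proof -
    obtain s where s: "0 < s" "s < t" "X s \<omega> \<noteq> X 0 \<omega>" using t by blast
    have t0: "0 \<le> t" "0 \<le> s" using t s by auto
    obtain d where d: "0 < d" "\<And>r. t \<le> r \<Longrightarrow> r < t + d \<Longrightarrow> X r \<omega> = X t \<omega>"
      by (rule right_continuous[OF w t0(1)]) (rule that)
    obtain e where e: "0 < e" "\<And>r. s \<le> r \<Longrightarrow> r < s + e \<Longrightarrow> X r \<omega> = X s \<omega>"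
      by (rule right_continuous[OF w t0(2)]) (rule that)
    have "\<forall>\<^sub>F n in sequentially. h n < min e (t - s)"
      using h(2) e(1) s(2) by (intro order_tendstoD(2)) auto
    then have "\<forall>\<^sub>F n in sequentially. \<forall>k. t \<le> real k * h n \<longrightarrow> real k * h n < t + d \<longrightarrow> p n k"
    proof eventually_elim
      case (elim n)
      define j where "j = nat \<lceil>s / h n\<rceil>"
      have "0 \<le> s / h n" using s h(1)[of n] by simp
      then have "s / h n \<le> real j" "real j < s / h n + 1" unfolding j_def by linarith+
      then have j: "s \<le> real j * h n" "real j * h n < s + h n"
        using h(1)[of n] by (auto simp: field_simps)
      show ?case
      proof (intro allI impI)
        fix k assume k: "t \<le> real k * h n" "real k * h n < t + d"
        have "real j * h n \<le> real k * h n" using j(2) k(1) elim by simp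
        then have "j \<le> k" using h(1)[of n] by simp
        moreover have "X (real j * h n) \<omega> = X s \<omega>" by (rule e(2)) (use j elim in auto)
        moreover have "X (real k * h n) \<omega> = X t \<omega>" by (rule d(2)[OF k])
        ultimately show "p n k" using t s(3) unfolding p_def by metis
      qed
    qed
    then show ?thesis using d(1) by blast
  qed
  note * = grid_first_time_tendsto[where p = p, OF h ret_def _ low app]
  show "ret X S \<omega> \<le> first_time (h n) (p n)" using *(1) by force
  show "(\<lambda>n. first_time (h n) (p n)) \<longlonglongrightarrow> ret X S \<omega>" using *(2) by force
qed

text \<open>The expectation of \<open>e\<^sup>-\<^sup>l\<^sup>\<tau>\<^sub>B\<close> on the event \<open>\<tau>\<^sub>B < \<tau>\<^sub>A\<close>. It covers the Laplace transform of
  \<open>\<tau>\<^sub>B\<close>, with empty \<open>A\<close>, and the equilibrium potential, with \<open>l = 0\<close>.\<close>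

definition hit_value :: "real \<Rightarrow> 'a set \<Rightarrow> 'a set \<Rightarrow> 'a \<Rightarrow> real" where
  "hit_value l A B x = (\<integral>\<omega>. discount_before l (hit X B \<omega>) (hit X A \<omega>) \<partial>P x)"

definition grid_value :: "real \<Rightarrow> 'a set \<Rightarrow> 'a set \<Rightarrow> real \<Rightarrow> 'a \<Rightarrow> real" where
  "grid_value l A B h x = (\<integral>\<omega>. discount_before l (first_time h (\<lambda>k. X (real k * h) \<omega> \<in> B))
      (first_time h (\<lambda>k. X (real k * h) \<omega> \<in> A)) \<partial>P x)"

lemma borel_measurable_skeleton: "0 \<le> h \<Longrightarrow> (\<lambda>\<omega>. F (skeleton h N \<omega>) :: real) \<in> borel_measurable (P x)"
  using integrable_skeleton by blast

lemma discount_before_bound: "0 \<le> l \<Longrightarrow> \<bar>discount_before l T S\<bar> \<le> 1"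
  by (simp add: discount_before_def)

lemma grid_value_limit:
  assumes h: "0 < h" and disj: "A \<inter> B = {}" and l: "0 \<le> l"
  shows "(\<lambda>N. \<integral>\<omega>. first_hit (exp (- (l * h))) A B (skeleton h N \<omega>) \<partial>P x) \<longlonglongrightarrow> grid_value l A B h x"
    and "(\<lambda>\<omega>. discount_before l (first_time h (\<lambda>k. X (real k * h) \<omega> \<in> B))
      (first_time h (\<lambda>k. X (real k * h) \<omega> \<in> A))) \<in> borel_measurable (P x)"
proof -
  have b: "\<bar>first_hit (exp (- (l * h))) A B ys\<bar> \<le> 1" for ys
    using first_hit_bound[of "exp (- (l * h))" A B ys] h l by simp
  have lim: "(\<lambda>N. first_hit (exp (- (l * h))) A B (skeleton h N \<omega>)) \<longlonglongrightarrow>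
      discount_before l (first_time h (\<lambda>k. X (real k * h) \<omega> \<in> B))
      (first_time h (\<lambda>k. X (real k * h) \<omega> \<in> A))" for \<omega>
    unfolding skeleton_def by (rule first_hit_tendsto[OF h disj])
  note m = borel_measurable_skeleton[OF less_imp_le[OF h], of "first_hit (exp (- (l * h))) A B"]
  note * = expectation_of_limit[OF lim m b]
  show "(\<lambda>N. \<integral>\<omega>. first_hit (exp (- (l * h))) A B (skeleton h N \<omega>) \<partial>P x) \<longlonglongrightarrow> grid_value l A B h x"
    unfolding grid_value_def by (rule *(2))
  show "(\<lambda>\<omega>. discount_before l (first_time h (\<lambda>k. X (real k * h) \<omega> \<in> B))
      (first_time h (\<lambda>k. X (real k * h) \<omega> \<in> A))) \<in> borel_measurable (P x)"
    by (rule *(1))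
qed

lemma grid_value_step:
  assumes h: "0 < h" and disj: "A \<inter> B = {}" and l: "0 \<le> l" and x: "x \<notin> A \<union> B"
  shows "grid_value l A B h x
    = exp (- (l * h)) * (\<Sum>y\<in>UNIV. semigroup_of G h x y * grid_value l A B h y)"
proof (rule LIMSEQ_unique)
  let ?q = "exp (- (l * h))"
  show "(\<lambda>N. \<integral>\<omega>. first_hit ?q A B (skeleton h (Suc N) \<omega>) \<partial>P x) \<longlonglongrightarrow> grid_value l A B h x"
    using LIMSEQ_Suc[OF grid_value_limit(1)[OF h disj l]] .
  have "(\<integral>\<omega>. first_hit ?q A B (skeleton h (Suc N) \<omega>) \<partial>P x)
      = ?q * (\<Sum>y\<in>UNIV. semigroup_of G h x y * (\<integral>\<omega>. first_hit ?q A B (skeleton h N \<omega>) \<partial>P y))" for N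
    using x by (subst expectation_skeleton_Suc[OF less_imp_le[OF h]])
      (simp add: sum_distrib_left mult_ac)
  then show "(\<lambda>N. \<integral>\<omega>. first_hit ?q A B (skeleton h (Suc N) \<omega>) \<partial>P x)
      \<longlonglongrightarrow> ?q * (\<Sum>y\<in>UNIV. semigroup_of G h x y * grid_value l A B h y)"
    by (simp only:) (intro tendsto_intros grid_value_limit(1)[OF h disj l])
qed

lemma hit_value_limit:
  assumes h: "\<And>n. 0 < h n" "h \<longlonglongrightarrow> 0" and disj: "A \<inter> B = {}" and l: "0 \<le> l"
  shows "(\<lambda>n. grid_value l A B (h n) x) \<longlonglongrightarrow> hit_value l A B x"
    and "(\<lambda>\<omega>. discount_before l (hit X B \<omega>) (hit X A \<omega>)) \<in> borel_measurable (P x)"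
proof -
  have lim: "(\<lambda>n. discount_before l (first_time (h n) (\<lambda>k. X (real k * h n) \<omega> \<in> B))
      (first_time (h n) (\<lambda>k. X (real k * h n) \<omega> \<in> A)))
      \<longlonglongrightarrow> discount_before l (hit X B \<omega>) (hit X A \<omega>)" if w: "\<omega> \<in> space (P x)" for \<omega>
    using hit_grid[OF w h] hit_eq_infinite[OF w disj] by (intro discount_before_tendsto) auto
  note * = expectation_of_limit[OF lim grid_value_limit(2)[OF h(1) disj l] discount_before_bound[OF l]]
  show "(\<lambda>n. grid_value l A B (h n) x) \<longlonglongrightarrow> hit_value l A B x"
    unfolding hit_value_def grid_value_def by (rule *(2))
  show "(\<lambda>\<omega>. discount_before l (hit X B \<omega>) (hit X A \<omega>)) \<in> borel_measurable (P x)"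
    by (rule *(1))
qed

lemma hit_value_generator:
  assumes disj: "A \<inter> B = {}" and l: "0 \<le> l" and x: "x \<notin> A \<union> B"
  shows "l * hit_value l A B x = gen_app G (hit_value l A B) x"
  by (rule generator_limit[OF mesh hit_value_limit(1)[OF mesh disj l]
        grid_value_step[OF mesh(1) disj l x]])

lemma hit_start: "X 0 \<omega> \<in> S \<Longrightarrow> hit X S \<omega> = 0"
  unfolding hit_def by (intro antisym Inf_lower) (auto intro!: exI[of _ "0::real"])

lemma hit_value_boundary:
  assumes disj: "A \<inter> B = {}" and l: "0 \<le> l"
  shows "x \<in> B \<Longrightarrow> hit_value l A B x = 1" "x \<in> A \<Longrightarrow> hit_value l A B x = 0"
proof -
  interpret prob_space "P x" by (rule prob_space_P)
  note meas = hit_value_limit(2)[OF mesh disj l, of x]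
  show "hit_value l A B x = 1" if x: "x \<in> B"
  proof -
    have "AE \<omega> in P x. discount_before l (hit X B \<omega>) (hit X A \<omega>) = 1"
      using AE_start[of x] AE_space
    proof eventually_elim
      case (elim \<omega>)
      then have 0: "hit X B \<omega> = 0" using x by (intro hit_start) simp
      then have "hit X A \<omega> \<noteq> 0" using hit_eq_infinite[OF elim(2) disj] by auto
      then show ?case using 0 by (simp add: discount_before_def zero_less_iff_neq_zero)
    qed
    then have "hit_value l A B x = (\<integral>\<omega>. 1 \<partial>P x)"
      unfolding hit_value_def by (intro integral_cong_AE meas) auto
    then show ?thesis by (simp add: prob_space)
  qed
  show "hit_value l A B x = 0" if x: "x \<in> A"
  proof -
    have "AE \<omega> in P x. discount_before l (hit X B \<omega>) (hit X A \<omega>) = 0"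
      using AE_start[of x]
    proof eventually_elim
      case (elim \<omega>)
      then have "hit X A \<omega> = 0" using x by (intro hit_start) simp
      then show ?case by (simp add: discount_before_def)
    qed
    then have "hit_value l A B x = (\<integral>\<omega>. 0 \<partial>P x)"
      unfolding hit_value_def by (intro integral_cong_AE meas) auto
    then show ?thesis by simp
  qed
qed

lemma hit_value_bounds:
  assumes "A \<inter> B = {}" "0 \<le> l" shows "0 \<le> hit_value l A B x" "hit_value l A B x \<le> 1"
proof -
  interpret prob_space "P x" by (rule prob_space_P)
  show "0 \<le> hit_value l A B x"
    unfolding hit_value_def by (intro integral_nonneg_AE) (simp add: discount_before_def)
  show "hit_value l A B x \<le> 1"
    unfolding hit_value_def
    using hit_value_limit(2)[OF mesh assms] discount_before_bound[OF assms(2)]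
    by (intro integral_le_const integrable_const_bound[of _ 1]) (auto simp: discount_before_def assms)
qed

lemma laplace_hit_eq: "0 < l \<Longrightarrow> (\<integral>\<omega>. discount l (hit X B \<omega>) \<partial>P x) = hit_value l {} B x"
  unfolding hit_value_def discount_def discount_before_def
  by (intro Bochner_Integration.integral_cong) (auto simp: hit_def[of _ "{}"] less_top top_unique)

lemma laplace_hit_measurable: "0 < l \<Longrightarrow> (\<lambda>\<omega>. discount l (hit X B \<omega>)) \<in> borel_measurable (P x)"
proof -
  assume l: "0 < l"
  have "(\<lambda>\<omega>. discount l (hit X B \<omega>)) = (\<lambda>\<omega>. discount_before l (hit X B \<omega>) (hit X {} \<omega>))"
    by (auto simp: discount_def discount_before_def hit_def[of _ "{}"] less_top top_unique)
  then show ?thesis using hit_value_limit(2)[OF mesh, of "{}" B l x] l by simp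
qed

definition escape_prob :: "'a set \<Rightarrow> 'a set \<Rightarrow> 'a \<Rightarrow> real" where
  "escape_prob A B x = (\<integral>\<omega>. discount_before 0 (ret X B \<omega>) (ret X A \<omega>) \<partial>P x)"

definition grid_ret :: "real \<Rightarrow> 'a set \<Rightarrow> 'w \<Rightarrow> ennreal" where
  "grid_ret h S \<omega> = first_time h (\<lambda>k. X (real k * h) \<omega> \<in> S \<and> (\<exists>j\<le>k. X (real j * h) \<omega> \<noteq> X 0 \<omega>))"

lemma grid_escape_limit:
  assumes h: "0 < h" and disj: "A \<inter> B = {}"
  shows "(\<lambda>N. \<integral>\<omega>. first_return (hd (skeleton h N \<omega>)) A B (skeleton h N \<omega>) \<partial>P x)
      \<longlonglongrightarrow> (\<integral>\<omega>. discount_before 0 (grid_ret h B \<omega>) (grid_ret h A \<omega>) \<partial>P x)"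
    and "(\<lambda>\<omega>. discount_before 0 (grid_ret h B \<omega>) (grid_ret h A \<omega>)) \<in> borel_measurable (P x)"
proof -
  have b: "\<bar>first_return (hd ys) A B ys\<bar> \<le> 1" for ys
    using first_return_bound[of "hd ys" A B ys] by simp
  have hd: "hd (skeleton h N \<omega>) = X 0 \<omega>" for N \<omega>
    by (simp add: skeleton_def map_upt_shift del: upt_Suc)
  have lim: "(\<lambda>N. first_return (hd (skeleton h N \<omega>)) A B (skeleton h N \<omega>))
      \<longlonglongrightarrow> discount_before 0 (grid_ret h B \<omega>) (grid_ret h A \<omega>)" for \<omega>
    unfolding hd unfolding skeleton_def grid_ret_def by (rule first_return_tendsto[OF h disj])
  note m = borel_measurable_skeleton[OF less_imp_le[OF h], of "\<lambda>l. first_return (hd l) A B l"]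
  note * = expectation_of_limit[OF lim m b]
  show "(\<lambda>N. \<integral>\<omega>. first_return (hd (skeleton h N \<omega>)) A B (skeleton h N \<omega>) \<partial>P x)
      \<longlonglongrightarrow> (\<integral>\<omega>. discount_before 0 (grid_ret h B \<omega>) (grid_ret h A \<omega>) \<partial>P x)"
    by (rule *(2))
  show "(\<lambda>\<omega>. discount_before 0 (grid_ret h B \<omega>) (grid_ret h A \<omega>)) \<in> borel_measurable (P x)"
    by (rule *(1))
qed

lemma expectation_skeleton_cong:
  assumes "0 \<le> h" "\<And>ys. F (x # ys) = F' (x # ys)"
  shows "(\<integral>\<omega>. F (skeleton h N \<omega>) \<partial>P x) = (\<integral>\<omega>. (F' (skeleton h N \<omega>) :: real) \<partial>P x)"
  using assms by (simp add: expectation_skeleton)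

lemma grid_escape_step:
  assumes h: "0 < h" and disj: "A \<inter> B = {}"
  defines "W \<equiv> \<lambda>x. \<integral>\<omega>. discount_before 0 (grid_ret h B \<omega>) (grid_ret h A \<omega>) \<partial>P x"
  shows "W x = (\<Sum>y\<in>UNIV. semigroup_of G h x y * (if y = x then W x else grid_value 0 A B h y))"
proof (rule LIMSEQ_unique)
  let ?F = "\<lambda>l. first_return (hd l) A B l"
  have h0: "0 \<le> h" using h by simp
  show "(\<lambda>N. \<integral>\<omega>. ?F (skeleton h (Suc N) \<omega>) \<partial>P x) \<longlonglongrightarrow> W x"
    unfolding W_def using LIMSEQ_Suc[OF grid_escape_limit(1)[OF h disj]] .
  have "(\<integral>\<omega>. ?F (skeleton h (Suc N) \<omega>) \<partial>P x)
      = (\<Sum>y\<in>UNIV. semigroup_of G h x y * (if y = x then (\<integral>\<omega>. ?F (skeleton h N \<omega>) \<partial>P x)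
        else (\<integral>\<omega>. first_hit 1 A B (skeleton h N \<omega>) \<partial>P y)))" for N
  proof (subst expectation_skeleton_Suc[OF h0], intro sum.cong refl arg_cong2[of _ _ _ _ "(*)"])
    fix y
    show "(\<integral>\<omega>. ?F (x # skeleton h N \<omega>) \<partial>P y) = (if y = x then (\<integral>\<omega>. ?F (skeleton h N \<omega>) \<partial>P x)
        else (\<integral>\<omega>. first_hit 1 A B (skeleton h N \<omega>) \<partial>P y))"
      using expectation_skeleton_cong[OF h0, of "\<lambda>l. ?F (x # l)" y "if y = x then ?F else first_hit 1 A B" N]
      by (auto split: if_splits)
  qed
  then show "(\<lambda>N. \<integral>\<omega>. ?F (skeleton h (Suc N) \<omega>) \<partial>P x)
      \<longlonglongrightarrow> (\<Sum>y\<in>UNIV. semigroup_of G h x y * (if y = x then W x else grid_value 0 A B h y))"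
  proof (simp only:, intro tendsto_sum tendsto_mult tendsto_const)
    fix y
    show "(\<lambda>N. if y = x then \<integral>\<omega>. ?F (skeleton h N \<omega>) \<partial>P x else (\<integral>\<omega>. first_hit 1 A B (skeleton h N \<omega>) \<partial>P y))
      \<longlonglongrightarrow> (if y = x then W x else grid_value 0 A B h y)"
      using grid_escape_limit(1)[OF h disj] grid_value_limit(1)[OF h disj, of 0 y]
      by (auto simp: W_def)
  qed
qed

lemma escape_limit:
  assumes disj: "A \<inter> B = {}"
  shows "(\<lambda>n. \<integral>\<omega>. discount_before 0 (grid_ret (mesh n) B \<omega>) (grid_ret (mesh n) A \<omega>) \<partial>P x)
    \<longlonglongrightarrow> escape_prob A B x"
proof -
  have lim: "(\<lambda>n. discount_before 0 (grid_ret (mesh n) B \<omega>) (grid_ret (mesh n) A \<omega>))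
      \<longlonglongrightarrow> discount_before 0 (ret X B \<omega>) (ret X A \<omega>)" if w: "\<omega> \<in> space (P x)" for \<omega>
    unfolding grid_ret_def
    using ret_grid[OF w mesh] ret_eq_infinite[OF w disj] by (intro discount_before_tendsto) auto
  show ?thesis
    unfolding escape_prob_def
    by (rule expectation_of_limit(2)[OF lim grid_escape_limit(2)[OF mesh(1) disj] discount_before_bound]) auto
qed

text \<open>Put the value \<open>escape_prob\<close> at \<open>x\<close> and the hitting probabilities at the other states. The first
  step decomposition of the return on the grid makes this function harmonic at \<open>x\<close> in the limit.
  Since the potential itself vanishes on \<open>A\<close>, removing the value at \<open>x\<close> leaves the claim.\<close>

lemma escape_rate:
  assumes disj: "A \<inter> B = {}" and x: "x \<in> A"
  shows "- G x x * escape_prob A B x = gen_app G (hit_value 0 A B) x"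
proof -
  define u where "u y = (if y = x then escape_prob A B x else hit_value 0 A B y)" for y
  let ?W = "\<lambda>n. \<integral>\<omega>. discount_before 0 (grid_ret (mesh n) B \<omega>) (grid_ret (mesh n) A \<omega>) \<partial>P x"
  have "0 * u x = gen_app G u x"
  proof (rule generator_limit[where h = mesh and z = "\<lambda>n y. if y = x then ?W n else grid_value 0 A B (mesh n) y"])
    show "(\<lambda>n. if y = x then ?W n else grid_value 0 A B (mesh n) y) \<longlonglongrightarrow> u y" for y
      using escape_limit[OF disj, of x] hit_value_limit(1)[OF mesh disj, of 0 y] by (auto simp: u_def)
    show "(if x = x then ?W n else grid_value 0 A B (mesh n) x) = exp (- (0 * mesh n)) *
        (\<Sum>y\<in>UNIV. semigroup_of G (mesh n) x y * (if y = x then ?W n else grid_value 0 A B (mesh n) y))" for n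
      using grid_escape_step[where x = x, OF mesh(1)[of n] disj] by simp
  qed (use mesh in auto)
  then have "G x x * escape_prob A B x + (\<Sum>y\<in>UNIV - {x}. G x y * hit_value 0 A B y) = 0"
    by (simp add: gen_app_def u_def sum.remove[of UNIV x])
  moreover have "hit_value 0 A B x = 0" using hit_value_boundary(2)[OF disj _ x] by simp
  ultimately show ?thesis by (simp add: gen_app_def sum.remove[of UNIV x])
qed

lemma escape_prob_eq:
  "measure (P x) {\<omega> \<in> space (P x). ret X A \<omega> > ret X B \<omega>} = escape_prob A B x"
proof -
  interpret prob_space "P x" by (rule prob_space_P)
  let ?E = "{\<omega> \<in> space (P x). ret X B \<omega> < ret X A \<omega>}"
  have "escape_prob A B x = (\<integral>\<omega>. indicator ?E \<omega> \<partial>P x)"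
    unfolding escape_prob_def
    by (intro Bochner_Integration.integral_cong) (auto simp: discount_before_def indicator_def)
  also have "\<dots> = measure (P x) (?E \<inter> space (P x))" by (rule Bochner_Integration.integral_indicator)
  finally show ?thesis by (simp add: Int_absorb2 Collect_conj_eq)
qed

lemma capacity_eq:
  assumes "A \<inter> B = {}"
  shows "capacity G \<pi> P X A B = (\<Sum>x\<in>A. \<pi> x * gen_app G (hit_value 0 A B) x)"
  unfolding capacity_def escape_prob_eq
  by (intro sum.cong refl) (simp add: escape_rate[OF assms, symmetric])

end

section \<open>Comparison of hitting times, commute times and capacities\<close>

lemma discount_slope_le:
  assumes l: "0 < l" shows "ennreal ((1 - discount l T) / l) \<le> T"
proof (cases T)
  case (real t)
  have "1 - l * t \<le> exp (- (l * t))" using exp_ge_add_one_self[of "- (l * t)"] by simp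
  then have "(1 - discount l T) / l \<le> t" using real l by (simp add: discount_def field_simps)
  then show ?thesis using real by (simp add: ennreal_leI)
qed simp

lemma discount_slope_tendsto:
  assumes h: "\<And>n. 0 < h n" "h \<longlonglongrightarrow> 0"
  shows "(\<lambda>n. ennreal ((1 - discount (h n) T) / h n)) \<longlonglongrightarrow> T"
proof -
  have at0: "filterlim h (at 0) sequentially"
    using h by (auto simp: filterlim_at intro!: always_eventually less_imp_neq[symmetric])
  show ?thesis
  proof (cases T)
    case (real t)
    have "((\<lambda>l. - exp (- (l * t))) has_real_derivative t) (at 0)"
      by (auto intro!: derivative_eq_intros)
    then have "((\<lambda>l. (1 - exp (- (l * t))) / l) \<longlongrightarrow> t) (at 0)"
      by (simp add: has_field_derivative_iff)
    then have "(\<lambda>n. (1 - exp (- (h n * t))) / h n) \<longlonglongrightarrow> t"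
      using at0 by (rule filterlim_compose)
    then show ?thesis using real by (simp add: discount_def tendsto_ennrealI)
  next
    case top
    have "filterlim (\<lambda>n. inverse (h n)) at_top sequentially"
      using h by (intro filterlim_inverse_at_top) auto
    then have "(\<lambda>n. ennreal (inverse (h n))) \<longlonglongrightarrow> \<infinity>"
      by (simp add: ennreal_tendsto_top_eq_at_top)
    then show ?thesis using top by (simp add: discount_def inverse_eq_divide)
  qed
qed

context realised_chain
begin

text \<open>The difference quotients \<open>(1 - e\<^sup>-\<^sup>l\<^sup>\<tau>)/l\<close> are at most \<open>\<tau>\<close> and converge to it, also where
  \<open>\<tau> = \<infinity>\<close>. The upper bound and Fatou's lemma give the convergence of the expectations.\<close>

lemma exp_hit_limit:
  "(\<lambda>n. ennreal ((1 - hit_value (mesh n) {} B x) / mesh n)) \<longlonglongrightarrow> exp_hit P X x B"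
proof -
  interpret prob_space "P x" by (rule prob_space_P)
  let ?g = "\<lambda>n \<omega>. (1 - discount (mesh n) (hit X B \<omega>)) / mesh n"
  note m0 = mesh(1)
  have d: "0 \<le> discount (mesh n) T" "discount (mesh n) T \<le> 1" for n T
    using m0[of n] by (auto simp: discount_def)
  have int: "integrable (P x) (\<lambda>\<omega>. discount (mesh n) (hit X B \<omega>))" for n
    using d by (intro integrable_const_bound[of _ 1] laplace_hit_measurable m0) auto
  have meas: "(\<lambda>\<omega>. ennreal (?g n \<omega>)) \<in> borel_measurable (P x)" for n
    using laplace_hit_measurable[OF m0[of n], of B x] by measurable
  have eq: "ennreal ((1 - hit_value (mesh n) {} B x) / mesh n) = (\<integral>\<^sup>+ \<omega>. ennreal (?g n \<omega>) \<partial>P x)" for n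
  proof -
    have "(\<integral>\<^sup>+ \<omega>. ennreal (?g n \<omega>) \<partial>P x) = ennreal (\<integral>\<omega>. ?g n \<omega> \<partial>P x)"
      using d m0[of n] int[of n] by (intro nn_integral_eq_integral) (auto simp: less_imp_le)
    also have "(\<integral>\<omega>. ?g n \<omega> \<partial>P x) = (1 - hit_value (mesh n) {} B x) / mesh n"
      using int[of n] by (simp add: laplace_hit_eq[OF m0] prob_space)
    finally show ?thesis by simp
  qed
  have up: "(\<integral>\<^sup>+ \<omega>. ennreal (?g n \<omega>) \<partial>P x) \<le> exp_hit P X x B" for n
    unfolding exp_hit_def by (intro nn_integral_mono discount_slope_le m0)
  have "exp_hit P X x B = (\<integral>\<^sup>+ \<omega>. liminf (\<lambda>n. ennreal (?g n \<omega>)) \<partial>P x)"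
    unfolding exp_hit_def
    by (intro nn_integral_cong lim_imp_Liminf[symmetric] discount_slope_tendsto mesh) simp
  also have "\<dots> \<le> liminf (\<lambda>n. \<integral>\<^sup>+ \<omega>. ennreal (?g n \<omega>) \<partial>P x)"
    by (rule nn_integral_liminf[OF meas])
  finally have low: "exp_hit P X x B \<le> liminf (\<lambda>n. \<integral>\<^sup>+ \<omega>. ennreal (?g n \<omega>) \<partial>P x)" .
  have high: "limsup (\<lambda>n. \<integral>\<^sup>+ \<omega>. ennreal (?g n \<omega>) \<partial>P x) \<le> exp_hit P X x B"
    by (rule Limsup_bounded) (simp add: up)
  have mid: "liminf (\<lambda>n. \<integral>\<^sup>+ \<omega>. ennreal (?g n \<omega>) \<partial>P x)
      \<le> limsup (\<lambda>n. \<integral>\<^sup>+ \<omega>. ennreal (?g n \<omega>) \<partial>P x)"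
    by (rule Liminf_le_Limsup) simp
  show ?thesis
    unfolding eq tendsto_iff_Liminf_eq_Limsup[OF sequentially_bot]
    using antisym[OF order_trans[OF mid high] low] antisym[OF high order_trans[OF low mid]] by simp
qed

end

locale reversible_chain =
  reversible_generator \<mu> G + realised_chain G P X
  for \<mu> :: "'a::finite \<Rightarrow> real" and G and P :: "'a \<Rightarrow> 'w measure" and X
begin

lemma quadratic_form_eq:
  "l * inner_wt \<mu> u u + energy u u = (\<Sum>x\<in>UNIV. \<mu> x * (l * u x - gen_app G u x) * u x)"
  by (simp add: energy_def inner_wt_def sum_distrib_left right_diff_distrib left_diff_distrib
      sum_subtractf sum_negf mult_ac)

text \<open>The function \<open>l u - G u\<close> is supported on \<open>B\<close>, where \<open>u = 1\<close>; so the form is the plain integral of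
  \<open>l u - G u\<close>, and \<open>G u\<close> has mean zero.\<close>

lemma laplace_eq_form:
  fixes B :: "'a set"
  assumes l: "0 < l" defines "u \<equiv> hit_value l {} B"
  shows "l * inner_wt \<mu> u u + energy u u = l * (\<Sum>x\<in>UNIV. \<mu> x * u x)"
proof -
  have one: "\<mu> x * (l * u x - gen_app G u x) * u x = \<mu> x * (l * u x - gen_app G u x)" for x
    using hit_value_boundary(1)[of "{}" B l x] hit_value_generator[of "{}" B l x] l
    by (cases "x \<in> B") (auto simp: u_def)
  have "l * inner_wt \<mu> u u + energy u u = (\<Sum>x\<in>UNIV. \<mu> x * (l * u x - gen_app G u x))"
    unfolding quadratic_form_eq by (intro sum.cong refl one)
  also have "\<dots> = l * (\<Sum>x\<in>UNIV. \<mu> x * u x)"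
    using mean_gen_app[of u]
    by (simp add: right_diff_distrib sum_subtractf sum_distrib_left mult_ac)
  finally show ?thesis .
qed

text \<open>The flux \<open>\<mu> G u\<close> out of \<open>A\<close> enters \<open>B\<close>, as its total is 0 and it vanishes elsewhere.\<close>

lemma capacity_eq_energy:
  assumes disj: "A \<inter> B = {}"
  shows "capacity G \<mu> P X A B = energy (hit_value 0 A B) (hit_value 0 A B)"
proof -
  let ?u = "hit_value 0 A B"
  have uA: "?u x = 0" if "x \<in> A" for x using hit_value_boundary(2)[OF disj _ that] by simp
  have uB: "?u x = 1" if "x \<in> B" for x using hit_value_boundary(1)[OF disj _ that] by simp
  have uH: "gen_app G ?u x = 0" if "x \<notin> A \<union> B" for x
    using hit_value_generator[OF disj _ that, of 0] by simp
  have "energy ?u ?u = (\<Sum>x\<in>UNIV. - (\<mu> x * gen_app G ?u x) * ?u x)"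
    using quadratic_form_eq[of 0 ?u] by simp
  also have "\<dots> = (\<Sum>x\<in>UNIV. (if x \<in> A then \<mu> x * gen_app G ?u x else 0) - \<mu> x * gen_app G ?u x)"
  proof (intro sum.cong refl)
    fix x
    consider "x \<in> A" | "x \<in> B" "x \<notin> A" | "x \<notin> A \<union> B" by blast
    then show "- (\<mu> x * gen_app G ?u x) * ?u x
        = (if x \<in> A then \<mu> x * gen_app G ?u x else 0) - \<mu> x * gen_app G ?u x"
      by cases (simp_all add: uA uB uH)
  qed
  also have "\<dots> = (\<Sum>x\<in>A. \<mu> x * gen_app G ?u x)"
    using mean_gen_app[of ?u] by (simp add: sum_subtractf sum.If_cases)
  finally show ?thesis using capacity_eq[OF disj] by simp
qed

text \<open>The operator that is \<open>G\<close> off \<open>y\<close> and the evaluation at \<open>y\<close> is injective if \<open>G\<close> is irreducible, hence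
  bounded below in finite dimension. It maps \<open>(1 - u)/l\<close> to \<open>-u\<close> off \<open>y\<close> and to 0 at \<open>y\<close>, and \<open>u\<close> takes
  values in \<open>[0,1]\<close>. The resulting bound is uniform in \<open>l\<close>, so expected hitting times are finite.\<close>

lemma hit_time_bounded:
  assumes irr: "irreducible_gen G"
  shows "\<exists>K. \<forall>l>0. \<forall>z. (1 - hit_value l {} {y} z) / l \<le> K"
proof -
  define L :: "real^'a \<Rightarrow> real^'a"
    where "L v = (\<chi> z. if z = y then v $ y else gen_app G (($) v) z)" for v
  have lin: "linear L"
    by (rule linearI)
      (auto simp: L_def vec_eq_iff gen_app_def algebra_simps sum.distrib sum_distrib_left)
  have "inj L"
  proof (rule linear_injective_0[OF lin, THEN iffD2], intro allI impI)
    fix v assume "L v = 0"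
    then have 0: "(if z = y then v $ y else gen_app G (($) v) z) = 0" for z
      by (simp add: L_def vec_eq_iff)
    then have vy: "v $ y = 0" using 0[of y] by simp
    have "energy (($) v) (($) v) = 0"
      unfolding energy_def inner_wt_def
    proof (intro sum.neutral ballI)
      show "- gen_app G (($) v) z * v $ z * \<mu> z = 0" for z using 0[of z] by (cases "z = y") auto
    qed
    then have "v $ z = v $ y" for z using energy_zero_const[OF irr] by blast
    then show "v = 0" using vy by (simp add: vec_eq_iff)
  qed
  then obtain b where b: "0 < b" "\<And>v. b * norm v \<le> norm (L v)"
    using linear_inj_bounded_below_pos[OF lin] by blast
  show ?thesis
  proof (intro exI allI impI)
    fix l :: real and z assume l: "0 < l"
    let ?u = "hit_value l {} {y}"
    define v :: "real^'a" where "v = (\<chi> z. (1 - ?u z) / l)"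
    have "\<bar>L v $ z\<bar> \<le> 1" for z
    proof (cases "z = y")
      case True
      then show ?thesis using hit_value_boundary(1)[of "{}" "{y}" l y] l by (simp add: L_def v_def)
    next
      case False
      have "gen_app G (($) v) z = gen_app G (\<lambda>z. (1 / l) * (1 - ?u z)) z"
        by (simp add: v_def gen_app_def)
      also have "\<dots> = - (gen_app G ?u z) / l"
        unfolding gen_app_cmult gen_app_diff gen_app_const by simp
      also have "\<dots> = - ?u z" using hit_value_generator[of "{}" "{y}" l z] False l by (simp add: field_simps)
      finally show ?thesis using False hit_value_bounds[of "{}" "{y}" l z] l by (simp add: L_def)
    qed
    then have "norm (L v) \<le> CARD('a)"
      using norm_le_l1_cart[of "L v"] sum_mono[of UNIV "\<lambda>z. \<bar>L v $ z\<bar>" "\<lambda>_. 1"] by simp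
    then have "norm v \<le> CARD('a) / b" using b(1) b(2)[of v] by (simp add: field_simps)
    then have "v $ z \<le> CARD('a) / b" using component_le_norm_cart[of v z] by simp
    then show "(1 - ?u z) / l \<le> CARD('a) / b" by (simp add: v_def)
  qed
qed

text \<open>Let \<open>l \<rightarrow> 0\<close> in the equation of the Laplace transform; off \<open>y\<close> this gives \<open>G T = -1\<close>. The value at \<open>y\<close>
  is forced by \<open>\<mu>(G T) = 0\<close>.\<close>

lemma expected_hitting_time:
  assumes irr: "irreducible_gen G"
  obtains T where "\<And>z. 0 \<le> T z" "\<And>z. exp_hit P X z {y} = ennreal (T z)" "T y = 0"
    "\<And>z. gen_app G T z = (if z = y then 1 / \<mu> y else 0) - 1"
proof -
  define u where "u n = hit_value (mesh n) {} {y}" for n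
  define g where "g n z = (1 - u n z) / mesh n" for n z
  define T where "T z = enn2real (exp_hit P X z {y})" for z
  note m0 = mesh(1)
  have g0: "0 \<le> g n z" for n z
    using hit_value_bounds(2)[of "{}" "{y}" "mesh n" z] m0[of n] by (simp add: g_def u_def)
  obtain K where K: "\<And>n z. g n z \<le> K"
    using hit_time_bounded[OF irr, of y] m0 unfolding g_def u_def by blast
  have lim: "(\<lambda>n. ennreal (g n z)) \<longlonglongrightarrow> exp_hit P X z {y}" for z
    unfolding g_def u_def by (rule exp_hit_limit)
  have "exp_hit P X z {y} \<le> ennreal K" for z
    by (rule LIMSEQ_le_const2[OF lim]) (use K in \<open>auto intro!: ennreal_leI\<close>)
  then have fin: "exp_hit P X z {y} < \<infinity>" for z
    by (metis ennreal_less_top infinity_ennreal_def le_less_trans)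
  have glim: "(\<lambda>n. g n z) \<longlonglongrightarrow> T z" for z
  proof -
    have e: "exp_hit P X z {y} = ennreal (T z)" using fin[of z] by (simp add: T_def)
    show ?thesis
      using tendsto_enn2real[OF lim[of z, unfolded e]] g0 by (simp add: T_def)
  qed
  have Ty: "T y = 0"
  proof -
    have "g n y = 0" for n
      using hit_value_boundary(1)[of "{}" "{y}" "mesh n" y] m0[of n] by (simp add: g_def u_def)
    then show ?thesis using glim[of y] by (simp add: LIMSEQ_const_iff)
  qed
  have off: "gen_app G T z = - 1" if z: "z \<noteq> y" for z
  proof (rule LIMSEQ_unique)
    show "(\<lambda>n. gen_app G (g n) z) \<longlonglongrightarrow> gen_app G T z"
      unfolding gen_app_def by (intro tendsto_intros glim)
    have "gen_app G (g n) z = - (1 - mesh n * g n z)" for n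
    proof -
      have "g n = (\<lambda>z. (1 / mesh n) * (1 - u n z))"
        by (simp add: g_def fun_eq_iff)
      then have "gen_app G (g n) z = gen_app G (\<lambda>z. (1 / mesh n) * (1 - u n z)) z"
        by simp
      also have "\<dots> = - (gen_app G (u n) z) / mesh n"
        unfolding gen_app_cmult gen_app_diff gen_app_const by simp
      also have "gen_app G (u n) z = mesh n * u n z"
        using hit_value_generator[of "{}" "{y}" "mesh n" z] z m0[of n] by (simp add: u_def)
      finally have "gen_app G (g n) z = - u n z" using m0[of n] by simp
      moreover have "1 - mesh n * g n z = u n z" using m0[of n] by (simp add: g_def)
      ultimately show ?thesis by simp
    qed
    moreover have "(\<lambda>n. - (1 - mesh n * g n z)) \<longlonglongrightarrow> - (1 - 0 * T z)"
      by (intro tendsto_intros mesh(2) glim)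
    ultimately show "(\<lambda>n. gen_app G (g n) z) \<longlonglongrightarrow> - 1" by simp
  qed
  have "(\<Sum>z\<in>UNIV. \<mu> z * gen_app G T z) = \<mu> y * gen_app G T y + (\<Sum>z\<in>UNIV - {y}. - \<mu> z)"
    by (simp add: sum.remove[of UNIV y] off)
  moreover have "(\<Sum>z\<in>UNIV - {y}. - \<mu> z) = \<mu> y - 1"
    using weight_sum by (simp add: sum.remove[of UNIV y] sum_negf)
  ultimately have "\<mu> y * gen_app G T y = 1 - \<mu> y" using mean_gen_app[of T] by simp
  then have at: "gen_app G T y = 1 / \<mu> y - 1" using weight_pos[of y] by (simp add: field_simps)
  show ?thesis
  proof (rule that[of T])
    show "gen_app G T z = (if z = y then 1 / \<mu> y else 0) - 1" for z using off at by simp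
  qed (use Ty fin in \<open>auto simp: T_def less_top\<close>)
qed

lemma commute_time_poisson:
  assumes irr: "irreducible_gen G" and xy: "x \<noteq> y"
  defines "h \<equiv> \<lambda>z. (if z = y then 1 / \<mu> y else 0) - (if z = x then 1 / \<mu> x else 0)"
  obtains f where "gen_app G f = h" "t_com P X x y = ennreal (- inner_wt \<mu> h f)"
proof -
  obtain S where S: "\<And>z. 0 \<le> S z" "\<And>z. exp_hit P X z {x} = ennreal (S z)" "S x = 0"
    "\<And>z. gen_app G S z = (if z = x then 1 / \<mu> x else 0) - 1"
    using expected_hitting_time[OF irr, of x] by blast
  obtain T where T: "\<And>z. 0 \<le> T z" "\<And>z. exp_hit P X z {y} = ennreal (T z)" "T y = 0"
    "\<And>z. gen_app G T z = (if z = y then 1 / \<mu> y else 0) - 1"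
    using expected_hitting_time[OF irr, of y] by blast
  let ?f = "\<lambda>z. T z - S z"
  have "inner_wt \<mu> h ?f = (\<Sum>z\<in>UNIV. (if z = y then ?f z else 0) - (if z = x then ?f z else 0))"
    unfolding inner_wt_def h_def using weight_pos
    by (intro sum.cong refl) (auto simp: field_simps less_imp_neq[symmetric])
  also have "\<dots> = ?f y - ?f x" by (simp add: sum_subtractf)
  finally have i: "- inner_wt \<mu> h ?f = T x + S y" using S(3) T(3) by simp
  show ?thesis
  proof (rule that[of ?f])
    show "gen_app G ?f = h" by (auto simp: fun_eq_iff gen_app_diff S(4) T(4) h_def)
    show "t_com P X x y = ennreal (- inner_wt \<mu> h ?f)"
      unfolding i t_com_def using S(1,2) T(1,2) by (simp add: ennreal_plus)
  qed
qed

lemma commute_time_self: "t_com P X x x = 0"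
proof -
  have "(\<lambda>n. ennreal ((1 - hit_value (mesh n) {} {x} x) / mesh n)) = (\<lambda>n. 0)"
  proof
    fix n
    show "ennreal ((1 - hit_value (mesh n) {} {x} x) / mesh n) = 0"
      using hit_value_boundary(1)[of "{}" "{x}" "mesh n" x] mesh(1)[of n] by simp
  qed
  then have "exp_hit P X x {x} = 0"
    using exp_hit_limit[of "{x}" x] by (simp add: LIMSEQ_const_iff)
  then show ?thesis by (simp add: t_com_def)
qed

end

lemma t_av_eq: "t_av \<pi> P X = (\<Sum>y\<in>UNIV. ennreal (\<pi> y) * exp_hit_init \<pi> P X {y})"
  unfolding t_av_def exp_hit_init_def sum_distrib_left
  by (subst sum.swap) (simp add: mult_ac)

locale ordered_chains =
  ordered_generators \<mu> M1 M2 + chain1: reversible_chain \<mu> M1 P1 X1 + chain2: reversible_chain \<mu> M2 P2 X2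
  for \<mu> :: "'a::finite \<Rightarrow> real" and M1 M2
    and P1 :: "'a \<Rightarrow> 'w1 measure" and X1 and P2 :: "'a \<Rightarrow> 'w2 measure" and X2
begin

text \<open>The values \<open>u2\<close> of the faster chain compete in the Dirichlet principle of the slower one.\<close>

lemma form_le:
  assumes l: "0 \<le> l" and disj: "A \<inter> B = {}"
  defines "u1 \<equiv> chain1.hit_value l A B" and "u2 \<equiv> chain2.hit_value l A B"
  shows "l * inner_wt \<mu> u1 u1 + slow.energy u1 u1 \<le> l * inner_wt \<mu> u2 u2 + fast.energy u2 u2"
proof -
  have "l * inner_wt \<mu> u1 u1 + slow.energy u1 u1 \<le> l * inner_wt \<mu> u2 u2 + slow.energy u2 u2"
  proof (rule slow.dirichlet_principle[OF l, of "A \<union> B"])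
    show "u2 x = u1 x" if "x \<in> A \<union> B" for x
      using that chain1.hit_value_boundary[OF disj l, of x] chain2.hit_value_boundary[OF disj l, of x]
      by (auto simp: u1_def u2_def)
    show "l * u1 x = gen_app M1 u1 x" if "x \<notin> A \<union> B" for x
      unfolding u1_def by (rule chain1.hit_value_generator[OF disj l that])
  qed
  then show ?thesis using energy_le[of u2] by linarith
qed

lemma mean_hit_value_le:
  assumes l: "0 < l"
  shows "(\<Sum>x\<in>UNIV. \<mu> x * chain1.hit_value l {} B x) \<le> (\<Sum>x\<in>UNIV. \<mu> x * chain2.hit_value l {} B x)"
proof -
  have "l * (\<Sum>x\<in>UNIV. \<mu> x * chain1.hit_value l {} B x)
      \<le> l * (\<Sum>x\<in>UNIV. \<mu> x * chain2.hit_value l {} B x)"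
    using form_le[of l "{}" B] l chain1.laplace_eq_form[OF l, of B] chain2.laplace_eq_form[OF l, of B]
    by simp
  then show ?thesis using l by simp
qed

lemma laplace_hit_init_le:
  "0 < l \<Longrightarrow> laplace_hit_init \<mu> P1 X1 l B \<le> laplace_hit_init \<mu> P2 X2 l B"
  using mean_hit_value_le[of l B]
  by (simp add: laplace_hit_init_def chain1.laplace_hit_eq chain2.laplace_hit_eq)

lemma exp_hit_init_ge: "exp_hit_init \<mu> P2 X2 B \<le> exp_hit_init \<mu> P1 X1 B"
proof (rule LIMSEQ_le)
  let ?F = "\<lambda>u n. (\<Sum>x\<in>UNIV. ennreal (\<mu> x) * ennreal ((1 - u (mesh n) {} B x) / mesh n))"
  show "?F chain2.hit_value \<longlonglongrightarrow> exp_hit_init \<mu> P2 X2 B"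
    unfolding exp_hit_init_def by (intro tendsto_sum ennreal_tendsto_cmult chain2.exp_hit_limit) simp
  show "?F chain1.hit_value \<longlonglongrightarrow> exp_hit_init \<mu> P1 X1 B"
    unfolding exp_hit_init_def by (intro tendsto_sum ennreal_tendsto_cmult chain1.exp_hit_limit) simp
  have F: "?F u n = ennreal ((1 - (\<Sum>x\<in>UNIV. \<mu> x * u (mesh n) {} B x)) / mesh n)"
    if "\<And>x. u (mesh n) {} B x \<le> 1" for u n
  proof -
    have "?F u n = ennreal (\<Sum>x\<in>UNIV. \<mu> x * ((1 - u (mesh n) {} B x) / mesh n))"
      using that slow.weight_pos mesh(1)[of n]
      by (simp add: less_imp_le flip: ennreal_mult sum_ennreal)
    also have "(\<Sum>x\<in>UNIV. \<mu> x * ((1 - u (mesh n) {} B x) / mesh n))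
        = ((\<Sum>x\<in>UNIV. \<mu> x) - (\<Sum>x\<in>UNIV. \<mu> x * u (mesh n) {} B x)) / mesh n"
      by (simp add: right_diff_distrib diff_divide_distrib sum_subtractf sum_divide_distrib)
    finally show ?thesis by (simp add: slow.weight_sum)
  qed
  have "?F chain2.hit_value n \<le> ?F chain1.hit_value n" for n
    using mesh(1)[of n] mean_hit_value_le[of "mesh n" B]
      chain1.hit_value_bounds(2)[of "{}" B "mesh n"] chain2.hit_value_bounds(2)[of "{}" B "mesh n"]
    by (simp add: F ennreal_leI divide_right_mono)
  then show "\<exists>N. \<forall>n\<ge>N. ?F chain2.hit_value n \<le> ?F chain1.hit_value n" by blast
qed

lemma t_av_ge: "t_av \<mu> P2 X2 \<le> t_av \<mu> P1 X1"
  unfolding t_av_eq by (intro sum_mono mult_left_mono exp_hit_init_ge) simp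

lemma capacity_le:
  "A \<inter> B = {} \<Longrightarrow> capacity M1 \<mu> P1 X1 A B \<le> capacity M2 \<mu> P2 X2 A B"
  using form_le[of 0 A B] by (simp add: chain1.capacity_eq_energy chain2.capacity_eq_energy)

text \<open>For \<open>x = y\<close> the right-hand side \<open>h\<close> of the Poisson equation is 0 and both commute times vanish.\<close>

lemma t_com_ge:
  assumes "irreducible_gen M1" "irreducible_gen M2"
  shows "t_com P2 X2 x y \<le> t_com P1 X1 x y"
proof (cases "x = y")
  case True
  then show ?thesis by (simp add: chain2.commute_time_self)
next
  case False
  let ?h = "\<lambda>z. (if z = y then 1 / \<mu> y else 0) - (if z = x then 1 / \<mu> x else 0)"
  obtain f1 where f1: "gen_app M1 f1 = ?h" "t_com P1 X1 x y = ennreal (- inner_wt \<mu> ?h f1)"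
    by (rule chain1.commute_time_poisson[OF assms(1) False]) (rule that)
  obtain f2 where f2: "gen_app M2 f2 = ?h" "t_com P2 X2 x y = ennreal (- inner_wt \<mu> ?h f2)"
    by (rule chain2.commute_time_poisson[OF assms(2) False]) (rule that)
  show ?thesis unfolding f1(2) f2(2) by (intro ennreal_leI poisson_inner_le f1(1) f2(1))
qed

end

section \<open>The Metropolis-Hastings generators\<close>

lemma generator_fill_diagonal:
  assumes "\<And>x y. x \<noteq> y \<Longrightarrow> 0 \<le> r x y"
    and "\<And>x y. G x y = (if x = y then - (\<Sum>z\<in>UNIV - {x}. r x z) else r x y)"
  shows "generator G"
  unfolding generator_def
proof (intro conjI allI impI)
  show "(\<Sum>y\<in>UNIV. G x y) = 0" for x
  proof -
    have "(\<Sum>y\<in>UNIV - {x}. G x y) = (\<Sum>y\<in>UNIV - {x}. r x y)"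
      by (intro sum.cong) (auto simp: assms(2))
    then show ?thesis by (simp add: sum.remove[of UNIV x] assms(2)[of x x])
  qed
qed (use assms in auto)

lemma ordered_generators_MH:
  assumes \<mu>: "\<And>x. 0 < \<mu> x" "(\<Sum>x\<in>UNIV. \<mu> x) = 1" and Q: "generator Q"
  shows "ordered_generators \<mu> (MH1 Q \<mu>) (MH2 Q \<mu>)"
proof -
  have Q0: "0 \<le> Q x y" if "x \<noteq> y" for x y using Q that by (simp add: generator_def)
  have r0: "0 \<le> \<mu> y / \<mu> x * Q y x" if "x \<noteq> y" for x y
    using Q0[of y x] \<mu>(1)[of x] \<mu>(1)[of y] that by simp
  show ?thesis
  proof unfold_locales
    show "generator (MH1 Q \<mu>)"
      by (rule generator_fill_diagonal[where r = "\<lambda>x z. min (Q x z) (\<mu> z / \<mu> x * Q z x)"])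
        (use Q0 r0 in \<open>auto simp: MH1_def\<close>)
    show "generator (MH2 Q \<mu>)"
      by (rule generator_fill_diagonal[where r = "\<lambda>x z. max (Q x z) (\<mu> z / \<mu> x * Q z x)"])
        (use Q0 r0 in \<open>auto simp: MH2_def le_max_iff_disj\<close>)
    show "\<mu> x * MH1 Q \<mu> x y = \<mu> y * MH1 Q \<mu> y x" for x y
      using \<mu>(1)[of x] \<mu>(1)[of y]
      by (auto simp: MH1_def min_mult_distrib_left min.commute)
    show "\<mu> x * MH2 Q \<mu> x y = \<mu> y * MH2 Q \<mu> y x" for x y
      using \<mu>(1)[of x] \<mu>(1)[of y]
      by (auto simp: MH2_def max_mult_distrib_left max.commute)
    show "MH1 Q \<mu> x y \<le> MH2 Q \<mu> x y" if "x \<noteq> y" for x y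
      using that by (simp add: MH1_def MH2_def)
  qed (use \<mu> in auto)
qed

lemma irreducible_MH2:
  assumes "irreducible_gen Q" shows "irreducible_gen (MH2 Q \<mu>)"
proof -
  have "{(u, v). u \<noteq> v \<and> 0 < Q u v} \<subseteq> {(u, v). u \<noteq> v \<and> 0 < MH2 Q \<mu> u v}"
    by (auto simp: MH2_def)
  then show ?thesis using assms rtrancl_mono unfolding irreducible_gen_def by blast
qed

theorem theorem4p1:
  fixes \<mu> :: "'a::finite \<Rightarrow> real"
  assumes "prob_vec \<mu>" and "\<forall>x. 0 < \<mu> x"
  shows "\<exists>C>0. \<forall>Q. generator Q \<and> irreducible_gen Q \<longrightarrow>
    \<comment> \<open>hitting times\<close>
    (\<forall>(P1 :: 'a \<Rightarrow> 'w1 measure) X1 (P2 :: 'a \<Rightarrow> 'w2 measure) X2.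
       ctmc (MH1 Q \<mu>) P1 X1 \<and> ctmc (MH2 Q \<mu>) P2 X2 \<longrightarrow>
         (\<forall>l>0. \<forall>A. laplace_hit_init \<mu> P1 X1 l A \<le> laplace_hit_init \<mu> P2 X2 l A) \<and>
         (\<forall>A. exp_hit_init \<mu> P1 X1 A \<ge> exp_hit_init \<mu> P2 X2 A) \<and>
         t_av \<mu> P1 X1 \<ge> t_av \<mu> P2 X2) \<and>
    \<comment> \<open>mixing time; \<open>C\<close> depends on \<open>\<mu>\<close> only\<close>
    t_mix (MH2 Q \<mu>) \<mu> (1/4) \<le> ennreal C * t_mix (MH1 Q \<mu>) \<mu> (1/4) \<and>
    \<comment> \<open>spectral gap\<close>
    spectral_gap (MH1 Q \<mu>) \<mu> \<le> spectral_gap (MH2 Q \<mu>) \<mu> \<and>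
    t_rel (MH1 Q \<mu>) \<mu> \<ge> t_rel (MH2 Q \<mu>) \<mu> \<and>
    \<comment> \<open>asymptotic variance\<close>
    (\<forall>h. mean \<mu> h = 0 \<longrightarrow> asymp_var h (MH1 Q \<mu>) \<mu> \<ge> asymp_var h (MH2 Q \<mu>) \<mu>) \<and>
    \<comment> \<open>large deviations\<close>
    (\<forall>\<nu>. prob_vec \<nu> \<longrightarrow> ld_rate (MH1 Q \<mu>) \<nu> \<le> ld_rate (MH2 Q \<mu>) \<nu>) \<and>
    \<comment> \<open>capacity and commute times\<close>
    (\<forall>(P1 :: 'a \<Rightarrow> 'w1 measure) X1 (P2 :: 'a \<Rightarrow> 'w2 measure) X2.
       ctmc (MH1 Q \<mu>) P1 X1 \<and> ctmc (MH2 Q \<mu>) P2 X2 \<longrightarrow>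
         (\<forall>A B. A \<inter> B = {} \<longrightarrow>
            capacity (MH1 Q \<mu>) \<mu> P1 X1 A B \<le> capacity (MH2 Q \<mu>) \<mu> P2 X2 A B) \<and>
         (irreducible_gen (MH1 Q \<mu>) \<longrightarrow>
            (\<forall>x y. t_com P1 X1 x y \<ge> t_com P2 X2 x y)))"
proof -
  have \<mu>: "\<And>x. 0 < \<mu> x" "(\<Sum>x\<in>UNIV. \<mu> x) = 1"
    using assms by (auto simp: prob_vec_def)
  obtain C where C: "0 < C" "\<And>M1 M2. ordered_generators \<mu> M1 M2 \<Longrightarrow>
      t_mix M2 \<mu> (1/4) \<le> ennreal C * t_mix M1 \<mu> (1/4)"
    using mixing_constant[of \<mu>, OF \<mu>(1)] by blast
  show ?thesis
  proof (intro exI[of _ C] conjI[OF C(1)] allI impI, goal_cases)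
    case (1 Q)
    interpret ordered_generators \<mu> "MH1 Q \<mu>" "MH2 Q \<mu>"
      by (rule ordered_generators_MH[OF \<mu>]) (use 1 in blast)
    have irr2: "irreducible_gen (MH2 Q \<mu>)" using 1 by (blast intro: irreducible_MH2)
    have chains: "ordered_chains \<mu> (MH1 Q \<mu>) (MH2 Q \<mu>) P1 X1 P2 X2"
      if "ctmc (MH1 Q \<mu>) P1 X1 \<and> ctmc (MH2 Q \<mu>) P2 X2"
      for P1 :: "'a \<Rightarrow> 'w1 measure" and X1 and P2 :: "'a \<Rightarrow> 'w2 measure" and X2
      using that by unfold_locales auto
    show ?case
    proof (intro conjI allI impI, goal_cases)
      case 1
      then show ?case by (intro ordered_chains.laplace_hit_init_le[OF chains])
    next
      case 2
      then show ?case by (intro ordered_chains.exp_hit_init_ge[OF chains])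
    next
      case 3
      then show ?case by (intro ordered_chains.t_av_ge[OF chains])
    next
      case 4
      show ?case by (intro C(2) ordered_generators_axioms)
    next
      case 5
      show ?case by (rule spectral_gap_le)
    next
      case 6
      show ?case by (rule t_rel_ge)
    next
      case 7
      then show ?case by (intro asymp_var_ge irr2)
    next
      case 8
      then show ?case by (intro ld_rate_le) (simp add: prob_vec_def)
    next
      case 9
      then show ?case by (intro ordered_chains.capacity_le[OF chains])
    next
      case 10
      then show ?case by (intro ordered_chains.t_com_ge[OF chains] irr2)
    qed
  qed
qed

end
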